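(* Let $(S_0,S_1,\dots)$ be a supermartingale relative to a nondecreasing sequence of $\sigma$-algebras $H_{\le0}\subseteq H_{\le1}\subseteq\cdots$, with $S_0\le0$ a.s. and differences $X_i:=S_i-S_{i-1}$. Let $d>0$ and $\sigma_i>0$ ($i=1,2,\dots$) be non-random constants such that $X_i\le d$ and $\operatorname{Var}(X_i\mid H_{\le i-1})\le\sigma_i^2$ a.s. for every $i$. Fix $n\ge1$, let $\sigma^2:=\frac1n(\sigma_1^2+\dots+\sigma_n^2)$ and $h:=d+\sigma^2/d$. Let $T_n:=Z_1+\dots+Z_n$, where $Z_1,\dots,Z_n$ are i.i.d. with $\mathbf{P}(Z_i=d)=\frac{\sigma^2}{d^2+\sigma^2}$ and $\mathbf{P}(Z_i=-\sigma^2/d)=\frac{d^2}{d^2+\sigma^2}$. Then $$\mathbf{P}(S_n\ge y)\le c_2\,\mathbf{P}^{\mathrm{Lin,LC}}\Big(T_n\ge y+\frac h2\Big)\quad\text{for all } y\in\mathbb{R},$$ where $c_2:=e^2/2$.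
   Context: $T_n$ takes values in the lattice $L_{n,d,h}:=\{nd+kh:k\in\mathbb{Z}\}$. The function $y\mapsto\mathbf{P}^{\mathrm{Lin}}(T_n\ge y)$ is the linear interpolation of the tail function $y\mapsto\mathbf{P}(T_n\ge y)$ over $L_{n,d,h}$: $\mathbf{P}^{\mathrm{Lin}}(T_n\ge y)=(1-\gamma)\mathbf{P}(T_n\ge nd+kh)+\gamma\mathbf{P}(T_n\ge nd+(k+1)h)$ whenever $\gamma:=(y-nd-kh)/h\in[0,1]$ for some $k\in\mathbb{Z}$. The function $y\mapsto\mathbf{P}^{\mathrm{Lin,LC}}(T_n\ge y)$ is the least log-concave majorant of $y\mapsto\mathbf{P}^{\mathrm{Lin}}(T_n\ge y)$ on $\mathbb{R}$, i.e. the pointwise smallest function $g:\mathbb{R}\to[0,\infty)$ with $\ln g$ concave (allowing the value $-\infty$) and $g\ge\mathbf{P}^{\mathrm{Lin}}(T_n\ge\cdot)$. *)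

theory Defs
  imports "HOL-Probability.Probability"
begin

definition filtration :: "'a measure \<Rightarrow> (nat \<Rightarrow> 'a measure) \<Rightarrow> bool" where
  "filtration M F \<longleftrightarrow> (\<forall>i. subalgebra M (F i)) \<and> (\<forall>i. sets (F i) \<subseteq> sets (F (Suc i)))"

definition supermartingale :: "'a measure \<Rightarrow> (nat \<Rightarrow> 'a measure) \<Rightarrow> (nat \<Rightarrow> 'a \<Rightarrow> real) \<Rightarrow> bool" where
  "supermartingale M F S \<longleftrightarrow> filtration M F \<and>
     (\<forall>i. S i \<in> borel_measurable (F i)) \<and> (\<forall>i. integrable M (S i)) \<and>
     (\<forall>i. AE x in M. real_cond_exp M (F i) (S (Suc i)) x \<le> S i x)"

definition cond_var :: "'a measure \<Rightarrow> 'a measure \<Rightarrow> ('a \<Rightarrow> real) \<Rightarrow> 'a \<Rightarrow> ennreal" where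
  "cond_var M G X = nn_cond_exp M G (\<lambda>x. ennreal ((X x - real_cond_exp M G X x)\<^sup>2))"

fun iid_sum_pmf :: "nat \<Rightarrow> real pmf \<Rightarrow> real pmf" where
  "iid_sum_pmf 0 Z = return_pmf 0"
| "iid_sum_pmf (Suc n) Z = bind_pmf (iid_sum_pmf n Z) (\<lambda>t. map_pmf (\<lambda>z. t + z) Z)"

definition two_point_pmf :: "real \<Rightarrow> real \<Rightarrow> real pmf" where
  "two_point_pmf d s2 = map_pmf (\<lambda>b. if b then d else - s2 / d) (bernoulli_pmf (s2 / (d\<^sup>2 + s2)))"

definition tail :: "real pmf \<Rightarrow> real \<Rightarrow> real" where
  "tail T y = measure_pmf.prob T {t. y \<le> t}"

text \<open>Linear interpolation of the tail over the lattice {n d + k h : k \<in> \<int>}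
  (here a = n d is the lattice offset).\<close>
definition tail_lin :: "real pmf \<Rightarrow> real \<Rightarrow> real \<Rightarrow> real \<Rightarrow> real" where
  "tail_lin T a h y =
     (let k = \<lfloor>(y - a) / h\<rfloor>; \<gamma> = (y - a - of_int k * h) / h in
      (1 - \<gamma>) * tail T (a + of_int k * h) + \<gamma> * tail T (a + of_int (k + 1) * h))"

text \<open>g : R \<rightarrow> [0,\<infinity>) with ln g concave (value -\<infinity> allowed).\<close>
definition log_concave :: "(real \<Rightarrow> real) \<Rightarrow> bool" where
  "log_concave g \<longleftrightarrow> (\<forall>x. 0 \<le> g x) \<and>
     (\<forall>x y t. 0 < t \<and> t < 1 \<longrightarrow> g x powr (1 - t) * g y powr t \<le> g ((1 - t) * x + t * y))"

definition lc_majorant :: "(real \<Rightarrow> real) \<Rightarrow> real \<Rightarrow> real" where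
  "lc_majorant f y = Inf {g y | g. log_concave g \<and> (\<forall>x. f x \<le> g x)}"

end

theory Submission
  imports Defs "HOL-Real_Asymp.Real_Asymp"
begin

text \<open>Let \<open>x\<^sub>+ = max 0 x\<close>. For every \<open>t\<close> the function \<open>(x - t)\<^sub>+\<^sup>2\<close> is dominated on \<open>x \<le> d\<close> by a
  quadratic polynomial touching it at the atoms of the extremal two-point law, so conditioning step by
  step bounds the expectation of \<open>(S\<^sub>n - t)\<^sub>+\<^sup>2\<close> by that of a sum of independent two-point variables
  with variances \<open>\<sigma>\<^sub>i\<^sup>2\<close>. Moving two of these variances towards each other increases the expectation,
  which leads to \<open>T\<^sub>n\<close>, and by Jensen's inequality \<open>T\<^sub>n\<close> may be replaced by \<open>T\<^sub>n + h (U - 1/2)\<close> with \<open>U\<close>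
  uniform on \<open>[0, 1]\<close>. The tail of the latter variable at \<open>y\<close> is the interpolated tail of \<open>T\<^sub>n\<close> at
  \<open>y + h/2\<close>. A log-concave majorant \<open>g\<close> of the interpolated tail lies below an exponential of some
  rate \<open>-\<lambda>\<close> touching it at \<open>y + h/2\<close>, and Markov's inequality with \<open>t = y - 2/\<lambda>\<close> gives the factor
  \<open>e\<^sup>2/2\<close>.\<close>

section \<open>Smoothing the variances of two-point variables\<close>

definition sq_pos :: "real \<Rightarrow> real" where
  "sq_pos w = (max 0 w)\<^sup>2"

text \<open>If \<open>U\<close> equals \<open>b\<close> with probability \<open>d / b\<close> and \<open>0\<close> otherwise, then \<open>jump d b f w\<close> is the
  expectation of \<open>f (w - U)\<close>. For \<open>b = d + s / d\<close> the variable \<open>d - U\<close> has the two-point law with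
  upper atom \<open>d\<close>, mean \<open>0\<close> and variance \<open>s\<close>.\<close>

definition jump :: "real \<Rightarrow> real \<Rightarrow> (real \<Rightarrow> real) \<Rightarrow> real \<Rightarrow> real" where
  "jump d b f w = d / b * f (w - b) + (1 - d / b) * f w"

lemma sq_pos_nonneg [simp]: "0 \<le> sq_pos w"
  by (simp add: sq_pos_def)

lemma sq_pos_eq: "0 \<le> w \<Longrightarrow> sq_pos w = w\<^sup>2" "w \<le> 0 \<Longrightarrow> sq_pos w = 0"
  by (simp_all add: sq_pos_def)

lemma sq_pos_mono: "v \<le> w \<Longrightarrow> sq_pos v \<le> sq_pos w"
  by (auto simp: sq_pos_def intro!: power_mono)

lemma sq_pos_measurable [measurable]: "sq_pos \<in> borel_measurable borel"
  unfolding sq_pos_def by measurable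

lemma jump_nonneg:
  assumes "0 < d" "d \<le> b" "\<And>w. 0 \<le> f w"
  shows "0 \<le> jump d b f w"
  using assms by (simp add: jump_def)

lemma jump_mono:
  assumes "0 < d" "d \<le> b" "f \<le> g"
  shows "jump d b f \<le> jump d b g"
  unfolding jump_def le_fun_def
  using assms by (intro allI add_mono mult_left_mono) (auto simp: le_fun_def)

text \<open>Independent variables may be subtracted in either order. Hence
  \<open>fold_mset (jump d)\<close> can be unfolded in any order, and a family of jumps is described
  by the multiset of its sizes.\<close>

lemma jump_commute: "jump d a (jump d b f) = jump d b (jump d a f)"
  by (rule ext) (simp add: jump_def divide_inverse algebra_simps)

interpretation jump: comp_fun_commute "jump d"
  by unfold_locales (simp add: fun_eq_iff comp_def jump_commute)

text \<open>Only the outcome without any jump can leave a positive argument. For a fixed sum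
  \<open>a + b\<close> its weight depends on the product \<open>a * b\<close> alone.\<close>

lemma jump_pair_low:
  assumes "0 < a" "a \<le> b" "w \<le> a"
  shows "jump d a (jump d b sq_pos) w = (1 - d * (a + b - d) / (a * b)) * sq_pos w"
  using assms by (simp add: jump_def sq_pos_eq(2) field_simps)

text \<open>The surviving outcomes are no jump and the jump \<open>a\<close>. The right-hand side is
  arranged so that, for a fixed sum \<open>a + b\<close>, the sizes enter only through
  \<open>d * a\<close> and \<open>1 / b\<close>.\<close>

lemma jump_pair_mid:
  assumes "0 < a" "a \<le> w" "w \<le> b"
  shows "jump d a (jump d b sq_pos) w = w\<^sup>2 - 2 * d * w + d * (a + d) - d * (w\<^sup>2 - 2 * d * w + d * (a + b)) / b"
proof -
  have b: "b > 0" using assms by simp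
  have "jump d a (jump d b sq_pos) w = d / a * (1 - d / b) * (w - a)\<^sup>2 + (1 - d / a) * (1 - d / b) * w\<^sup>2"
    using assms by (simp add: jump_def sq_pos_eq)
  also have "\<dots> = w\<^sup>2 - 2 * d * w + d * (a + d) - d * (w\<^sup>2 - 2 * d * w + d * (a + b)) / b"
    using assms b by (simp add: field_simps power2_eq_square)
  finally show ?thesis .
qed

text \<open>Without truncation this is a second moment with mean \<open>w - 2 * d\<close> and
  variance \<open>d * (a + b - 2 * d)\<close>. Truncation matters only when both jumps occur, an
  outcome of weight \<open>d\<^sup>2 / (a * b)\<close>.\<close>

lemma jump_pair_high:
  assumes "0 < a" "a \<le> b" "b \<le> w"
  shows "jump d a (jump d b sq_pos) w
    = (w - 2 * d)\<^sup>2 + d * (a + b - 2 * d) - d\<^sup>2 / (a * b) * sq_pos (a + b - w)"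
proof -
  have b: "b > 0" using assms by simp
  have 1: "sq_pos (w - a - b) = (w - a - b)\<^sup>2 - sq_pos (a + b - w)"
    by (cases "w \<le> a + b") (simp_all add: sq_pos_eq power2_commute algebra_simps)
  have "jump d a (jump d b sq_pos) w =
    d / a * (d / b * ((w - a - b)\<^sup>2 - sq_pos (a + b - w)) + (1 - d / b) * (w - a)\<^sup>2) +
     (1 - d / a) * (d / b * (w - b)\<^sup>2 + (1 - d / b) * w\<^sup>2)"
    unfolding jump_def 1 using assms by (simp add: sq_pos_eq)
  also have "\<dots> = (w - 2 * d)\<^sup>2 + d * (a + b - 2 * d) - d\<^sup>2 / (a * b) * sq_pos (a + b - w)"
    using assms b by (simp add: field_simps power2_eq_square)
  finally show ?thesis .
qed

section \<open>Two jumps of fixed total size\<close>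

lemma mult_le_mult_of_sum_eq:
  fixes a b a' b' :: real
  assumes "a \<le> a'" "a' \<le> b'" "a + b = a' + b'"
  shows "a * b \<le> a' * b'"
proof -
  have b: "b = a' + b' - a" using assms by simp
  have "a' * b' - a * b = (a' - a) * (b' - a)" unfolding b by (simp add: algebra_simps)
  also have "\<dots> \<ge> 0" using assms by simp
  finally show ?thesis by simp
qed

text \<open>Moving the sizes together enlarges their product, hence the weight of the outcome
  without jumps.\<close>

lemma jump_pair_le_low:
  assumes "0 < d" "d \<le> a" "a \<le> a'" "a' \<le> b'" "a + b = a' + b'" "w \<le> a"
  shows "jump d a (jump d b sq_pos) w \<le> jump d a' (jump d b' sq_pos) w"
proof -
  have "d * (a' + b' - d) / (a' * b') \<le> d * (a' + b' - d) / (a * b)"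
    using assms mult_le_mult_of_sum_eq[of a a' b' b] by (intro divide_left_mono mult_nonneg_nonneg mult_pos_pos) auto
  then show ?thesis
    using assms by (subst (1 2) jump_pair_low) (auto intro!: mult_right_mono)
qed

text \<open>Passing from \<open>b\<close> to \<open>b'\<close> raises the term \<open>d * a\<close>
  by \<open>d * (b - b')\<close> and the subtracted term by \<open>d * (?B / b' - ?B / b)\<close>.
  The gain covers the loss as soon as \<open>?B \<le> b * b'\<close>.\<close>

lemma jump_pair_le_mid:
  assumes "0 < d" "d \<le> a" "a \<le> a'" "a' \<le> b'" "a + b = a' + b'" "a' \<le> w" "w \<le> b'"
  shows "jump d a (jump d b sq_pos) w \<le> jump d a' (jump d b' sq_pos) w"
proof -
  let ?c = "a' + b'" and ?B = "w\<^sup>2 - 2 * d * w + d * (a' + b')"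
  have pos: "b > 0" "b' > 0" "b' \<le> b" using assms by auto
  \<comment> \<open>This is \<open>?B \<le> b' * b'\<close> rearranged. In the second case
    \<open>a' \<le> w\<close> bounds \<open>?c - 2 * w\<close> by \<open>b' - w\<close>, and
    \<open>d\<close> is at most \<open>b' + w\<close>.\<close>
  have "d * (?c - 2 * w) \<le> (b' - w) * (b' + w)"
  proof (cases "?c \<le> 2 * w")
    case True
    then have "d * (?c - 2 * w) \<le> 0" using assms by (simp add: mult_le_0_iff)
    also have "0 \<le> (b' - w) * (b' + w)" using assms by simp
    finally show ?thesis .
  next
    case False
    have "(?c - 2 * w) * d \<le> (b' - w) * (b' + w)"
      using assms False by (intro mult_mono) auto
    then show ?thesis by (simp add: mult.commute)
  qed
  then have "?B \<le> b' * b'" by (simp add: algebra_simps power2_eq_square)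
  also have "\<dots> \<le> b * b'" using pos by simp
  finally have B: "?B \<le> b * b'" .
  have "?B * (b - b') / (b * b') \<le> (b - b')"
  proof -
    have "?B * (b - b') \<le> (b * b') * (b - b')" using B pos by (intro mult_right_mono) auto
    then show ?thesis using pos by (simp add: divide_le_eq mult.commute)
  qed
  also have "?B * (b - b') / (b * b') = ?B / b' - ?B / b" using pos by (simp add: field_simps)
  finally have "d * (?B / b' - ?B / b) \<le> d * (b - b')" using assms by (intro mult_left_mono) auto
  moreover have "b - b' = a' - a" using assms by simp
  ultimately have "d * (?B / b' - ?B / b) \<le> d * (a' - a)" by simp
  then show ?thesis using assms pos
    by (subst (1 2) jump_pair_mid) (simp_all add: algebra_simps)
qed

text \<open>For a fixed sum only the correction for two jumps varies, and its weight decreases as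
  the product of the sizes grows.\<close>

lemma jump_pair_le_high:
  assumes "0 < d" "d \<le> a" "a \<le> a'" "a' \<le> b'" "a + b = a' + b'" "b \<le> w"
  shows "jump d a (jump d b sq_pos) w \<le> jump d a' (jump d b' sq_pos) w"
proof -
  have "d\<^sup>2 / (a' * b') \<le> d\<^sup>2 / (a * b)"
    using assms mult_le_mult_of_sum_eq[of a a' b' b] by (intro divide_left_mono mult_pos_pos) auto
  then have "d\<^sup>2 / (a' * b') * sq_pos (a' + b' - w) \<le> d\<^sup>2 / (a * b) * sq_pos (a' + b' - w)"
    by (intro mult_right_mono) auto
  then show ?thesis
    using assms by (subst (1 2) jump_pair_high) auto
qed

text \<open>The closed form changes when \<open>w\<close> crosses one of the jump sizes. The path from \<open>(a, b)\<close> to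
  \<open>(a', b')\<close> is therefore cut at the pair one of whose members is \<open>w\<close>.\<close>

lemma jump_pair_le_ordered:
  assumes "0 < d" "d \<le> a" "a \<le> a'" "a' \<le> b'" "a + b = a' + b'"
  shows "jump d a (jump d b sq_pos) w \<le> jump d a' (jump d b' sq_pos) w"
proof -
  consider "w \<le> a" | "a \<le> w" "w \<le> a'" | "a' \<le> w" "w \<le> b'" | "b' \<le> w" "w \<le> b" | "b \<le> w"
    by linarith
  then show ?thesis
  proof cases
    case 2
    have "jump d a (jump d b sq_pos) w \<le> jump d w (jump d (a + b - w) sq_pos) w"
      using assms 2 by (intro jump_pair_le_mid) auto
    also have "\<dots> \<le> jump d a' (jump d b' sq_pos) w"
      using assms 2 by (intro jump_pair_le_low) auto
    finally show ?thesis .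
  next
    case 4
    have "jump d a (jump d b sq_pos) w \<le> jump d (a + b - w) (jump d w sq_pos) w"
      using assms 4 by (intro jump_pair_le_mid) auto
    also have "\<dots> \<le> jump d a' (jump d b' sq_pos) w"
      using assms 4 by (intro jump_pair_le_high) auto
    finally show ?thesis .
  qed (use assms in \<open>auto intro: jump_pair_le_low jump_pair_le_mid jump_pair_le_high\<close>)
qed

text \<open>Here \<open>a'\<close> may be either member of the new pair: it will be the mean jump
  size, and which member is larger is not known in advance.\<close>

lemma jump_pair_le:
  assumes "0 < d" "d \<le> a" "a \<le> a'" "a' \<le> b" "a + b = a' + b'"
  shows "jump d a (jump d b sq_pos) \<le> jump d a' (jump d b' sq_pos)"
proof (cases "a' \<le> b'")
  case True
  then show ?thesis using assms by (auto simp: le_fun_def intro: jump_pair_le_ordered)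
next
  case False
  then have "jump d a (jump d b sq_pos) \<le> jump d b' (jump d a' sq_pos)"
    using assms by (auto simp: le_fun_def intro!: jump_pair_le_ordered)
  then show ?thesis by (simp add: jump_commute)
qed

section \<open>Multisets of jump sizes\<close>

lemma fold_jump_mono:
  assumes "0 < d" "\<And>b. b \<in># B \<Longrightarrow> d \<le> b" "f \<le> g"
  shows "fold_mset (jump d) f B \<le> fold_mset (jump d) g B"
  using assms(2) by (induction B) (use assms in \<open>auto intro!: jump_mono\<close>)

lemma sum_mset_ge_const:
  fixes B :: "real multiset"
  shows "(\<forall>x\<in>#B. m \<le> x) \<Longrightarrow> real (size B) * m \<le> sum_mset B"
  by (induction B) (auto simp: algebra_simps)

text \<open>The equality case of \<open>sum_mset_ge_const\<close>. Its contrapositive provides an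
  element below the mean of a non-constant multiset; the next lemma, by negation, provides one above
  it.\<close>

lemma mset_eq_replicate_of_ge_const:
  fixes B :: "real multiset"
  assumes "\<forall>x\<in>#B. m \<le> x" "sum_mset B \<le> real (size B) * m"
  shows "B = replicate_mset (size B) m"
  using assms
proof (induction B)
  case (add x B)
  then have "real (size B) * m \<le> sum_mset B" using sum_mset_ge_const[of B m] by simp
  then have "x = m" "sum_mset B \<le> real (size B) * m" using add.prems by (auto simp: algebra_simps)
  then show ?case using add by simp
qed simp

lemma mset_eq_replicate_of_le_const:
  fixes B :: "real multiset"
  assumes "\<forall>x\<in>#B. x \<le> m" "real (size B) * m \<le> sum_mset B"
  shows "B = replicate_mset (size B) m"
proof -
  have "sum_mset (image_mset uminus B) = - sum_mset B" by (induction B) auto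
  then have "image_mset uminus B = replicate_mset (size B) (- m)"
    using mset_eq_replicate_of_ge_const[of "image_mset uminus B" "- m"] assms by simp
  then have "image_mset uminus (image_mset uminus B) = image_mset uminus (replicate_mset (size B) (- m))"
    by (rule arg_cong)
  then show ?thesis by (simp add: image_mset.compositionality comp_def)
qed

text \<open>Each step moves a jump size below the mean and one above it towards each other, keeping
  their sum and making one of them equal to the mean.\<close>

lemma fold_jump_le_replicate_mean:
  assumes "0 < d" "\<And>b. b \<in># B \<Longrightarrow> d \<le> b" "sum_mset B = real (size B) * m"
  shows "fold_mset (jump d) sq_pos B \<le> fold_mset (jump d) sq_pos (replicate_mset (size B) m)"
  using assms(2,3)
proof (induction "size (filter_mset (\<lambda>x. x \<noteq> m) B)" arbitrary: B rule: less_induct)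
  case less
  show ?case
  proof (cases "B = replicate_mset (size B) m")
    case True
    then show ?thesis by simp
  next
    case False
    obtain a where a: "a \<in># B" "a < m"
      using mset_eq_replicate_of_ge_const[of B m] less.prems(2) False by (metis not_le order_refl)
    obtain b where b: "b \<in># B" "m < b"
      using mset_eq_replicate_of_le_const[of B m] less.prems(2) False by (metis not_le order_refl)
    obtain C where "B = add_mset a C" using a by (metis mset_add)
    moreover have "b \<in># C" using b a calculation by auto
    then obtain D where "C = add_mset b D" by (metis mset_add)
    ultimately have B: "B = {#b, a#} + D" by simp
    define b' where "b' = a + b - m"
    let ?B = "{#b', m#} + D"
    have ge: "d \<le> a" "d \<le> m" "d \<le> b'" and geD: "x \<in># D \<Longrightarrow> d \<le> x" for x
      using less.prems(1)[of a] less.prems(1)[of x] a b B by (auto simp: b'_def)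
    have "fold_mset (jump d) sq_pos B \<le> fold_mset (jump d) sq_pos ?B"
    proof -
      have "jump d b (jump d a sq_pos) \<le> jump d b' (jump d m sq_pos)"
        unfolding jump_commute[of d b] jump_commute[of d b']
        using a b ge assms by (intro jump_pair_le) (auto simp: b'_def)
      then show ?thesis
        unfolding B jump.fold_mset_union using assms geD by (intro fold_jump_mono) auto
    qed
    \<comment> \<open>Two elements different from \<open>m\<close> are replaced by at most one,
      \<open>b'\<close>, so the induction measure drops.\<close>
    also have "fold_mset (jump d) sq_pos ?B \<le> fold_mset (jump d) sq_pos (replicate_mset (size ?B) m)"
      using less.prems a b ge geD unfolding B
      by (intro less.hyps) (auto simp: B b'_def algebra_simps)
    also have "size ?B = size B" by (simp add: B)
    finally show ?thesis .
  qed
qed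

section \<open>Conditioning on the past\<close>

text \<open>The parabola has its vertex at \<open>a\<close> and meets the left-hand side at
  \<open>x = d\<close>. Before squaring, the lines \<open>x + R\<close> and
  \<open>(d + R) / (d - a) * (x - a)\<close> meet at \<open>x = d\<close>, and at
  \<open>x = a\<close> the first is not above the second; so it stays below to the left of
  \<open>d\<close>.\<close>

lemma quadratic_tangent_upper:
  fixes x a d R :: real
  assumes "x \<le> d" "a < d" "0 \<le> d + R" "R + a \<le> 0"
  shows "sq_pos (x + R) \<le> (d + R)\<^sup>2 / (d - a)\<^sup>2 * (x - a)\<^sup>2"
proof (cases "x + R \<le> 0")
  case True
  then show ?thesis by (simp add: sq_pos_eq)
next
  case False
  have "(x + R) * (d - a) - (d + R) * (x - a) = (d - x) * (R + a)"
    by (simp add: algebra_simps)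
  also have "\<dots> \<le> 0" using assms by (simp add: mult_le_0_iff)
  finally have "x + R \<le> (d + R) / (d - a) * (x - a)" using assms by (simp add: field_simps)
  then have "(x + R)\<^sup>2 \<le> ((d + R) / (d - a) * (x - a))\<^sup>2" using False by (intro power_mono) auto
  then show ?thesis using False by (simp add: sq_pos_eq power_mult_distrib power_divide)
qed

text \<open>Coefficients \<open>(\<alpha>, \<beta>, \<gamma>)\<close> of a quadratic polynomial in \<open>x - m\<close> that dominates
  \<open>sq_pos (x + R)\<close> for \<open>x \<le> d\<close>: \<open>R\<close> is the value reached so far, \<open>m\<close> the conditional mean of the next increment \<open>x\<close>, and
  \<open>m - s / (d - m)\<close> the lower atom of the extremal law with mean \<open>m\<close>, variance \<open>s\<close> and upper atom
  \<open>d\<close>.\<close>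

definition quad_coeffs :: "real \<Rightarrow> real \<Rightarrow> real \<Rightarrow> real \<Rightarrow> real \<times> real \<times> real" where
  "quad_coeffs d s m R =
    (let a = m - s / (d - m); \<gamma> = (d + R)\<^sup>2 / (d - a)\<^sup>2 in
     if d + R \<le> 0 then (0, 0, 0)
     else if R + a \<le> 0 then (\<gamma> * (m - a)\<^sup>2, 2 * \<gamma> * (m - a), \<gamma>)
     else ((m + R)\<^sup>2, 2 * (m + R), 1))"

text \<open>The cases are the positions of the kink \<open>- R\<close>. At or beyond
  \<open>d\<close> the left-hand side vanishes; between the atoms the parabola with vertex at the
  lower atom serves; below the lower atom the untruncated square \<open>(x + R)\<^sup>2\<close>
  does.\<close>

lemma quad_coeffs_majorize:
  assumes "0 < d" "0 < s" "m \<le> 0" "x \<le> d" "quad_coeffs d s m R = (\<alpha>, \<beta>, \<gamma>)"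
  shows "sq_pos (x + R) \<le> \<alpha> + \<beta> * (x - m) + \<gamma> * (x - m)\<^sup>2"
proof -
  define a where "a = m - s / (d - m)"
  have "0 < s / (d - m)" using assms by (intro divide_pos_pos) auto
  then have "a < d" using assms unfolding a_def by linarith
  consider "d + R \<le> 0" | "d + R > 0" "R + a \<le> 0" | "d + R > 0" "R + a > 0" by linarith
  then show ?thesis
  proof cases
    case 1
    then show ?thesis using assms by (simp add: quad_coeffs_def Let_def sq_pos_eq)
  next
    case 2
    then have g: "\<gamma> = (d + R)\<^sup>2 / (d - a)\<^sup>2" and ab: "\<alpha> = \<gamma> * (m - a)\<^sup>2" "\<beta> = 2 * \<gamma> * (m - a)"
      using assms(5) by (auto simp: quad_coeffs_def Let_def a_def)
    have "sq_pos (x + R) \<le> \<gamma> * (x - a)\<^sup>2"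
      unfolding g using assms \<open>a < d\<close> 2 by (intro quadratic_tangent_upper) auto
    also have "\<dots> = \<alpha> + \<beta> * (x - m) + \<gamma> * (x - m)\<^sup>2"
      unfolding ab by (simp add: algebra_simps power2_eq_square)
    finally show ?thesis .
  next
    case 3
    then have "\<gamma> = 1" "\<alpha> = (m + R)\<^sup>2" "\<beta> = 2 * (m + R)"
      using assms(5) by (auto simp: quad_coeffs_def Let_def a_def)
    then have "\<alpha> + \<beta> * (x - m) + \<gamma> * (x - m)\<^sup>2 = (x + R)\<^sup>2"
      by (simp add: algebra_simps power2_eq_square)
    then show ?thesis by (simp add: sq_pos_def max_def)
  qed
qed

lemma two_point_weights:
  fixes d s :: real
  assumes "0 < d" "0 < s"
  shows "d / (d + s / d) = d\<^sup>2 / (d\<^sup>2 + s)" "1 - d\<^sup>2 / (d\<^sup>2 + s) = s / (d\<^sup>2 + s)"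
proof -
  have "d\<^sup>2 + s > 0" using assms by (simp add: add_pos_pos)
  then show "1 - d\<^sup>2 / (d\<^sup>2 + s) = s / (d\<^sup>2 + s)" by (simp add: field_simps)
  have "d + s / d = (d\<^sup>2 + s) / d" using assms by (simp add: field_simps power2_eq_square)
  then show "d / (d + s / d) = d\<^sup>2 / (d\<^sup>2 + s)" by (simp add: power2_eq_square)
qed

lemma jump_sq_pos_ge:
  assumes "0 < d" "0 < s"
  shows "s / (d\<^sup>2 + s) * sq_pos v \<le> jump d (d + s / d) sq_pos v"
  using assms by (simp add: jump_def two_point_weights)

text \<open>The left-hand side is the expectation of the majorizing polynomial under mean
  \<open>m\<close> and variance \<open>s\<close>; the right-hand side belongs to the centred
  two-point law. A mean below 0 is never an advantage, mainly because it lowers the mass that the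
  extremal law puts on \<open>d\<close>.\<close>

lemma quad_coeffs_le_jump:
  assumes "0 < d" "0 < s" "m \<le> 0" "quad_coeffs d s m R = (\<alpha>, \<beta>, \<gamma>)"
  shows "\<alpha> + \<gamma> * s \<le> jump d (d + s / d) sq_pos (R + d)"
proof -
  define a where "a = m - s / (d - m)"
  have "d - m > 0" using assms by simp
  have dsd: "d + s / d > 0" "d \<le> d + s / d" using assms by (simp_all add: add_pos_pos)
  have "0 < s / (d - m)" using assms by (intro divide_pos_pos) auto
  then have "a < d" using assms unfolding a_def by linarith
  have den: "(d - m)\<^sup>2 + s > 0" "d\<^sup>2 + s > 0" using assms by (simp_all add: add_nonneg_pos)
  \<comment> \<open>The common value is the mass of the upper atom \<open>d\<close> under the
    extremal law with mean \<open>m\<close> and variance \<open>s\<close>.\<close>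
  have val: "(s + (m - a)\<^sup>2) / (d - a)\<^sup>2 = s / ((d - m)\<^sup>2 + s)"
  proof -
    define D where "D = d - m"
    have D: "D > 0" "m - a = s / D" "d - a = (D\<^sup>2 + s) / D" "D\<^sup>2 + s > 0"
      using \<open>d - m > 0\<close> den by (auto simp: a_def D_def field_simps power2_eq_square)
    have "s + (s / D)\<^sup>2 = s * (D\<^sup>2 + s) / D\<^sup>2" using D by (simp add: field_simps power2_eq_square)
    then have "(s + (m - a)\<^sup>2) / (d - a)\<^sup>2 = s * (D\<^sup>2 + s) / (D\<^sup>2 + s)\<^sup>2"
      unfolding D using D(1) by (simp add: power_divide)
    also have "\<dots> = s / (D\<^sup>2 + s)" using D(4) by (simp add: power2_eq_square)
    finally show ?thesis by (simp add: D_def)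
  qed
  have pm: "s / ((d - m)\<^sup>2 + s) \<le> s / (d\<^sup>2 + s)"
    using assms den by (intro divide_left_mono add_mono power_mono mult_pos_pos) auto
  consider "d + R \<le> 0" | "d + R > 0" "R + a \<le> 0" | "d + R > 0" "R + a > 0" by linarith
  then show ?thesis
  proof cases
    case 1
    then show ?thesis using assms dsd by (auto simp: quad_coeffs_def Let_def intro!: jump_nonneg)
  next
    case 2
    have "\<gamma> = (d + R)\<^sup>2 / (d - a)\<^sup>2" "\<alpha> = \<gamma> * (m - a)\<^sup>2"
      using 2 assms by (auto simp: quad_coeffs_def Let_def a_def)
    then have "\<alpha> + \<gamma> * s = (d + R)\<^sup>2 * ((s + (m - a)\<^sup>2) / (d - a)\<^sup>2)" by (simp add: algebra_simps add_divide_distrib)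
    also have "\<dots> \<le> (d + R)\<^sup>2 * (s / (d\<^sup>2 + s))" unfolding val using pm by (intro mult_left_mono) auto
    also have "\<dots> = s / (d\<^sup>2 + s) * sq_pos (R + d)" using 2 by (simp add: sq_pos_eq add.commute)
    also have "\<dots> \<le> jump d (d + s / d) sq_pos (R + d)" by (rule jump_sq_pos_ge[OF assms(1,2)])
    finally show ?thesis .
  next
    case 3
    have co: "\<gamma> = 1" "\<alpha> = (m + R)\<^sup>2" using 3 assms by (auto simp: quad_coeffs_def Let_def a_def)
    have am: "a < m" using assms by (simp add: a_def)
    \<comment> \<open>For \<open>R \<ge> s / d\<close> neither atom of the centred law is truncated,
      so the right-hand side is the full second moment \<open>R\<^sup>2 + s\<close>.\<close>
    show ?thesis
    proof (cases "R \<ge> s / d")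
      case True
      have "(m + R)\<^sup>2 \<le> R\<^sup>2" using 3 am assms by (intro power_mono) auto
      moreover have "jump d (d + s / d) sq_pos (R + d) = R\<^sup>2 + s"
      proof -
        have "jump d (d + s / d) sq_pos (R + d) = d\<^sup>2 / (d\<^sup>2 + s) * (R - s / d)\<^sup>2 + s / (d\<^sup>2 + s) * (R + d)\<^sup>2"
          using True 3 assms by (simp add: jump_def sq_pos_eq two_point_weights)
        also have "\<dots> = (d\<^sup>2 * (R - s / d)\<^sup>2 + s * (R + d)\<^sup>2) / (d\<^sup>2 + s)"
          by (simp add: add_divide_distrib)
        also have "d\<^sup>2 * (R - s / d)\<^sup>2 = (d * R - s)\<^sup>2" using assms by (simp add: field_simps power2_eq_square)
        also have "(d * R - s)\<^sup>2 + s * (R + d)\<^sup>2 = (R\<^sup>2 + s) * (d\<^sup>2 + s)" by (simp add: algebra_simps power2_eq_square)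
        finally show ?thesis using den by simp
      qed
      ultimately show ?thesis using co by simp
    next
      case False
      define p where "p = s / (d\<^sup>2 + s)"
      have p: "0 \<le> p" "p \<le> 1" using assms den by (auto simp: p_def)
      text \<open>The two sides, as functions of \<open>R\<close>, are compared at \<open>R = - a\<close>; from there on the
        right-hand side grows faster as long as \<open>R \<le> s / d\<close>.\<close>
      have at_a: "(m - a)\<^sup>2 + s \<le> p * (d - a)\<^sup>2"
      proof -
        have "(s + (m - a)\<^sup>2) / (d - a)\<^sup>2 \<le> p" using pm val unfolding p_def by simp
        then show ?thesis using \<open>a < d\<close> by (simp add: pos_divide_le_eq add.commute)
      qed
      \<comment> \<open>The aim is \<open>R1\<close> and \<open>a1\<close>: up to a factor 2 they
        compare the derivatives of the two sides at \<open>R\<close> and at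
        \<open>- a\<close>.\<close>
      have "R \<le> p * (R + d)"
      proof -
        have "R * d \<le> s" using False assms by (simp add: field_simps)
        then have "R * d * d \<le> s * d" using assms by (intro mult_right_mono) auto
        then have "R * (d\<^sup>2 + s) \<le> s * (R + d)" by (simp add: algebra_simps power2_eq_square)
        then show ?thesis using den by (simp add: p_def pos_le_divide_eq)
      qed
      then have R1: "m + R \<le> p * (R + d)" using assms by simp
      have a1: "m - a \<le> p * (d - a)"
      proof -
        have "- a * (1 - p) \<le> R * (1 - p)" using 3 p by (intro mult_right_mono) auto
        then show ?thesis using \<open>R \<le> p * (R + d)\<close> assms(3) by (simp add: algebra_simps)
      qed
      \<comment> \<open>The increment of a quadratic function over an interval is the length times
        the average of the derivatives at the endpoints.\<close>
      have "(R + a) * ((m + R) + (m - a)) \<le> (R + a) * (p * (R + d) + p * (d - a))"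
        using 3 R1 a1 by (intro mult_left_mono) auto
      moreover have "(m + R)\<^sup>2 - (m - a)\<^sup>2 = (R + a) * ((m + R) + (m - a))"
        by (simp add: algebra_simps power2_eq_square)
      moreover have "p * (R + d)\<^sup>2 - p * (d - a)\<^sup>2 = (R + a) * (p * (R + d) + p * (d - a))"
        by (simp add: algebra_simps power2_eq_square)
      ultimately have "(m + R)\<^sup>2 + s \<le> p * (R + d)\<^sup>2" using at_a by linarith
      also have "\<dots> = s / (d\<^sup>2 + s) * sq_pos (R + d)" using 3 by (simp add: sq_pos_eq p_def)
      also have "\<dots> \<le> jump d (d + s / d) sq_pos (R + d)" by (rule jump_sq_pos_ge[OF assms(1,2)])
      finally show ?thesis using co by simp
    qed
  qed
qed

text \<open>The linear term integrates to 0 because \<open>X\<close> minus its conditional mean is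
  orthogonal to bounded \<open>F\<close>-measurable functions, and the conditional variance controls
  the quadratic term. Since the coefficients may be unbounded, this is done on the sets
  \<open>A N\<close> in \<open>F\<close> where they are bounded by \<open>N\<close>, followed by
  monotone convergence.\<close>

lemma (in finite_measure_subalgebra) nn_integral_le_of_cond_quadratic:
  fixes X W V \<alpha> \<beta> \<gamma> :: "'a \<Rightarrow> real"
  assumes X: "integrable M X" and s: "0 \<le> s"
    and var: "AE x in M. cond_var M F X x \<le> ennreal s"
    and meas: "\<alpha> \<in> borel_measurable F" "\<beta> \<in> borel_measurable F" "\<gamma> \<in> borel_measurable F"
    and [measurable]: "W \<in> borel_measurable M" "V \<in> borel_measurable M"
    and nonneg: "\<And>x. 0 \<le> \<alpha> x" "\<And>x. 0 \<le> \<gamma> x" "\<And>x. 0 \<le> W x"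
    and W: "AE x in M. W x \<le> \<alpha> x + \<beta> x * (X x - real_cond_exp M F X x)
              + \<gamma> x * (X x - real_cond_exp M F X x)\<^sup>2"
    and V: "AE x in M. \<alpha> x + \<gamma> x * s \<le> V x"
  shows "(\<integral>\<^sup>+x. ennreal (W x) \<partial>M) \<le> (\<integral>\<^sup>+x. ennreal (V x) \<partial>M)"
proof -
  define m where "m = real_cond_exp M F X"
  have m: "integrable M m" unfolding m_def using X by (rule real_cond_exp_int)
  have [measurable]: "X \<in> borel_measurable M" "m \<in> borel_measurable M"
    using X m by auto
  have Xm: "X \<in> borel_measurable M" by simp
  have [measurable]: "\<alpha> \<in> borel_measurable M" "\<beta> \<in> borel_measurable M" "\<gamma> \<in> borel_measurable M"
    using meas by (auto intro: measurable_from_subalg[OF subalg])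
  define Y where "Y x = X x - m x" for x
  have Y: "integrable M Y" unfolding Y_def using X m by simp
  have [measurable]: "Y \<in> borel_measurable M" using Y by auto
  have var': "AE x in M. nn_cond_exp M F (\<lambda>x. ennreal ((Y x)\<^sup>2)) x \<le> ennreal s"
    using var by (simp add: cond_var_def Y_def m_def)
  \<comment> \<open>Square integrability comes from the bound on the conditional variance, as
    \<open>nn_cond_exp\<close> preserves the integral.\<close>
  have Y2: "integrable M (\<lambda>x. (Y x)\<^sup>2)"
  proof (rule integrableI_nonneg)
    have "(\<integral>\<^sup>+x. ennreal ((Y x)\<^sup>2) \<partial>M) = (\<integral>\<^sup>+x. nn_cond_exp M F (\<lambda>x. ennreal ((Y x)\<^sup>2)) x \<partial>M)"
      using nn_cond_exp_intg[of "\<lambda>_. 1" "\<lambda>x. ennreal ((Y x)\<^sup>2)"] by simp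
    also have "\<dots> \<le> (\<integral>\<^sup>+x. ennreal s \<partial>M)"
      using var' by (rule nn_integral_mono_AE)
    also have "\<dots> < \<infinity>" by (simp add: ennreal_mult_less_top less_top[symmetric] ennreal_mult_eq_top_iff)
    finally show "(\<integral>\<^sup>+x. ennreal ((Y x)\<^sup>2) \<partial>M) < \<infinity>" .
  qed auto
  define A where "A N = {x \<in> space M. \<bar>\<alpha> x\<bar> \<le> real N \<and> \<bar>\<beta> x\<bar> \<le> real N \<and> \<bar>\<gamma> x\<bar> \<le> real N}" for N
  have AF: "A N \<in> sets F" for N
  proof -
    have "{x \<in> space F. \<bar>\<alpha> x\<bar> \<le> real N \<and> \<bar>\<beta> x\<bar> \<le> real N \<and> \<bar>\<gamma> x\<bar> \<le> real N} \<in> sets F"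
      using meas by measurable
    then show ?thesis using subalg by (simp add: A_def subalgebra_def)
  qed
  have AM [measurable]: "A N \<in> sets M" for N
    using AF subalg by (auto simp: subalgebra_def)
  have step: "(\<integral>\<^sup>+x. ennreal (W x) * indicator (A N) x \<partial>M) \<le> (\<integral>\<^sup>+x. ennreal (V x) \<partial>M)" for N
  proof -
    define I :: "'a \<Rightarrow> real" where "I = indicator (A N)"
    have I[measurable]: "I \<in> borel_measurable F" "I \<in> borel_measurable M"
      using AF by (auto simp: I_def)
    have I01: "0 \<le> I x" "I x \<le> 1" for x by (auto simp: I_def indicator_def)
    have bnd: "\<bar>I x * \<alpha> x\<bar> \<le> real N" "\<bar>I x * \<beta> x\<bar> \<le> real N" "\<bar>I x * \<gamma> x\<bar> \<le> real N" for x
      by (auto simp: I_def indicator_def A_def)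
    have int_mult: "integrable M (\<lambda>x. I x * c x * Z x)"
      if "integrable M Z" "c \<in> borel_measurable M" "\<And>x. \<bar>I x * c x\<bar> \<le> real N" for c Z
    proof (rule Bochner_Integration.integrable_bound)
      show "integrable M (\<lambda>x. real N * Z x)" using that by simp
      show "(\<lambda>x. I x * c x * Z x) \<in> borel_measurable M" using that by measurable
      show "AE x in M. norm (I x * c x * Z x) \<le> norm (real N * Z x)"
        using that(3) by (intro AE_I2) (simp only: norm_mult real_norm_def abs_mult[symmetric],
           simp add: abs_mult mult_right_mono)
    qed
    have ia: "integrable M (\<lambda>x. I x * \<alpha> x)" using int_mult[of "\<lambda>_. 1" \<alpha>] bnd by simp
    have ig: "integrable M (\<lambda>x. I x * \<gamma> x * s)" using int_mult[of "\<lambda>_. s" \<gamma>] bnd by simp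
    have ib: "integrable M (\<lambda>x. I x * \<beta> x * Y x)" using int_mult[of Y \<beta>] Y bnd by simp
    have ic: "integrable M (\<lambda>x. I x * \<gamma> x * (Y x)\<^sup>2)" using int_mult[of "\<lambda>x. (Y x)\<^sup>2" \<gamma>] Y2 bnd by simp
    have b0: "(\<integral>x. I x * \<beta> x * Y x \<partial>M) = 0"
    proof -
      have iX: "integrable M (\<lambda>x. I x * \<beta> x * X x)" using int_mult[of X \<beta>] X bnd by simp
      have im: "integrable M (\<lambda>x. I x * \<beta> x * m x)" using int_mult[of m \<beta>] m bnd by simp
      have "(\<integral>x. I x * \<beta> x * m x \<partial>M) = (\<integral>x. I x * \<beta> x * X x \<partial>M)"
        unfolding m_def using iX meas I by (intro real_cond_exp_intg(2)) auto
      then show ?thesis using iX im by (simp add: Y_def right_diff_distrib)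
    qed
    have c_le: "(\<integral>x. I x * \<gamma> x * (Y x)\<^sup>2 \<partial>M) \<le> (\<integral>x. I x * \<gamma> x * s \<partial>M)"
    proof -
      have "ennreal (\<integral>x. I x * \<gamma> x * (Y x)\<^sup>2 \<partial>M) = (\<integral>\<^sup>+x. ennreal (I x * \<gamma> x) * ennreal ((Y x)\<^sup>2) \<partial>M)"
        using ic I01 nonneg by (subst nn_integral_eq_integral[symmetric]) (auto simp: ennreal_mult')
      also have "\<dots> = (\<integral>\<^sup>+x. ennreal (I x * \<gamma> x) * nn_cond_exp M F (\<lambda>x. ennreal ((Y x)\<^sup>2)) x \<partial>M)"
        using meas I by (intro nn_cond_exp_intg[symmetric]) auto
      also have "\<dots> \<le> (\<integral>\<^sup>+x. ennreal (I x * \<gamma> x) * ennreal s \<partial>M)"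
        using var' by (intro nn_integral_mono_AE) (auto elim!: eventually_mono intro!: mult_left_mono)
      also have "\<dots> = (\<integral>\<^sup>+x. ennreal (I x * \<gamma> x * s) \<partial>M)"
        using I01 nonneg s by (simp add: ennreal_mult')
      also have "\<dots> = ennreal (\<integral>x. I x * \<gamma> x * s \<partial>M)"
        using ig I01 nonneg s by (intro nn_integral_eq_integral) auto
      finally show ?thesis
        using I01 nonneg s by (subst (asm) ennreal_le_iff) (auto intro!: integral_nonneg_AE)
    qed
    have W': "AE x in M. I x * W x \<le> I x * \<alpha> x + I x * \<beta> x * Y x + I x * \<gamma> x * (Y x)\<^sup>2"
      using W
    proof eventually_elim
      case (elim x)
      then have "I x * W x \<le> I x * (\<alpha> x + \<beta> x * Y x + \<gamma> x * (Y x)\<^sup>2)"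
        unfolding Y_def m_def using I01 by (intro mult_left_mono) auto
      then show ?case by (simp add: algebra_simps)
    qed
    have "(\<integral>\<^sup>+x. ennreal (W x) * indicator (A N) x \<partial>M) = (\<integral>\<^sup>+x. ennreal (I x * W x) \<partial>M)"
      by (intro nn_integral_cong) (auto simp: I_def indicator_def)
    also have "\<dots> \<le> (\<integral>\<^sup>+x. ennreal (I x * \<alpha> x + I x * \<beta> x * Y x + I x * \<gamma> x * (Y x)\<^sup>2) \<partial>M)"
      using W' by (intro nn_integral_mono_AE) (auto elim!: eventually_mono intro!: ennreal_leI)
    also have "\<dots> = ennreal (\<integral>x. I x * \<alpha> x + I x * \<beta> x * Y x + I x * \<gamma> x * (Y x)\<^sup>2 \<partial>M)"
    proof (intro nn_integral_eq_integral)
      \<comment> \<open>The linear term has no sign; the sum is nonnegative because it dominates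
        \<open>I x * W x\<close>.\<close>
      show "AE x in M. 0 \<le> I x * \<alpha> x + I x * \<beta> x * Y x + I x * \<gamma> x * (Y x)\<^sup>2"
        using W' by eventually_elim (use I01 nonneg(3) in \<open>meson mult_nonneg_nonneg order_trans\<close>)
    qed (use ia ib ic in auto)
    also have "\<dots> \<le> ennreal (\<integral>x. I x * \<alpha> x + I x * \<gamma> x * s \<partial>M)"
      using ia ib ic ig b0 c_le by (intro ennreal_leI) simp
    also have "\<dots> = (\<integral>\<^sup>+x. ennreal (I x * \<alpha> x + I x * \<gamma> x * s) \<partial>M)"
      using ia ig I01 nonneg s by (intro nn_integral_eq_integral[symmetric]) auto
    also have "\<dots> \<le> (\<integral>\<^sup>+x. ennreal (V x) \<partial>M)"
    proof (rule nn_integral_mono_AE)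
      show "AE x in M. ennreal (I x * \<alpha> x + I x * \<gamma> x * s) \<le> ennreal (V x)"
        using V
      proof eventually_elim
        case (elim x)
        have "I x * (\<alpha> x + \<gamma> x * s) \<le> 1 * (\<alpha> x + \<gamma> x * s)"
          using I01 nonneg s by (intro mult_right_mono) auto
        then show ?case using elim by (intro ennreal_leI) (simp add: algebra_simps)
      qed
    qed
    finally show ?thesis .
  qed
  have mono: "incseq (\<lambda>N x. ennreal (W x) * indicator (A N) x)"
    by (auto intro!: monoI le_funI mult_left_mono simp: A_def indicator_def)
  have "(SUP N. ennreal (W x) * indicator (A N) x) = ennreal (W x)" if "x \<in> space M" for x
  proof -
    obtain N where N: "max (\<bar>\<alpha> x\<bar>) (max (\<bar>\<beta> x\<bar>) (\<bar>\<gamma> x\<bar>)) \<le> real N" using real_arch_simple by blast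
    then have "x \<in> A N" using that by (simp add: A_def)
    then show ?thesis
      by (intro antisym SUP_least SUP_upper2[of N]) (auto simp: indicator_def)
  qed
  then have "(\<integral>\<^sup>+x. ennreal (W x) \<partial>M) = (\<integral>\<^sup>+x. (SUP N. ennreal (W x) * indicator (A N) x) \<partial>M)"
    by (intro nn_integral_cong) simp
  also have "\<dots> = (SUP N. \<integral>\<^sup>+x. ennreal (W x) * indicator (A N) x \<partial>M)"
    using mono by (intro nn_integral_monotone_convergence_SUP) auto
  also have "\<dots> \<le> (\<integral>\<^sup>+x. ennreal (V x) \<partial>M)" using step by (intro SUP_least)
  finally show ?thesis .
qed

section \<open>Replacing the increments by two-point variables\<close>

lemma jump_measurable [measurable]:
  assumes [measurable]: "f \<in> borel_measurable borel"
  shows "jump d b f \<in> borel_measurable borel"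
  unfolding jump_def by measurable

lemma quad_coeffs_measurable:
  assumes [measurable]: "m \<in> borel_measurable N" "R \<in> borel_measurable N"
  shows "(\<lambda>x. fst (quad_coeffs d s (m x) (R x))) \<in> borel_measurable N"
    "(\<lambda>x. fst (snd (quad_coeffs d s (m x) (R x)))) \<in> borel_measurable N"
    "(\<lambda>x. snd (snd (quad_coeffs d s (m x) (R x)))) \<in> borel_measurable N"
  unfolding quad_coeffs_def Let_def if_distrib[of fst] if_distrib[of snd] fst_conv snd_conv
  by measurable

text \<open>One step of conditioning: the increment \<open>X\<close> is replaced by
  \<open>d - U\<close>, with \<open>U\<close> as for \<open>jump\<close> and independent of the past
  \<open>R\<close>.\<close>

lemma (in finite_measure_subalgebra) nn_integral_sq_pos_add_le_jump:
  fixes X R :: "'a \<Rightarrow> real"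
  assumes X: "integrable M X" and d: "0 < d" and s: "0 < s"
    and var: "AE x in M. cond_var M F X x \<le> ennreal s"
    and le: "AE x in M. X x \<le> d"
    and mean: "AE x in M. real_cond_exp M F X x \<le> 0"
    and R: "R \<in> borel_measurable F"
  shows "(\<integral>\<^sup>+x. ennreal (sq_pos (X x + R x)) \<partial>M)
    \<le> (\<integral>\<^sup>+x. ennreal (jump d (d + s / d) sq_pos (R x + d)) \<partial>M)"
proof -
  define m where "m = real_cond_exp M F X"
  define co where "co x = quad_coeffs d s (m x) (R x)" for x
  have [measurable]: "R \<in> borel_measurable M" using R by (rule measurable_from_subalg[OF subalg])
  have [measurable]: "X \<in> borel_measurable M" using X by auto
  have m: "m \<in> borel_measurable F" unfolding m_def by simp
  have co: "quad_coeffs d s (m x) (R x) = (fst (co x), fst (snd (co x)), snd (snd (co x)))" for x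
    by (simp add: co_def)
  have pos: "0 \<le> fst (co x)" "0 \<le> snd (snd (co x))" for x
    by (auto simp: co_def quad_coeffs_def Let_def)
  show ?thesis
  proof (rule nn_integral_le_of_cond_quadratic[OF X less_imp_le[OF s] var])
    show "(\<lambda>x. fst (co x)) \<in> borel_measurable F" "(\<lambda>x. fst (snd (co x))) \<in> borel_measurable F"
      "(\<lambda>x. snd (snd (co x))) \<in> borel_measurable F"
      unfolding co_def using m R by (rule quad_coeffs_measurable)+
    show "AE x in M. sq_pos (X x + R x) \<le> fst (co x) + fst (snd (co x)) * (X x - real_cond_exp M F X x) +
          snd (snd (co x)) * (X x - real_cond_exp M F X x)\<^sup>2"
      using le mean
      by eventually_elim (use quad_coeffs_majorize[OF d s _ _ co] in \<open>simp add: m_def\<close>)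
    show "AE x in M. fst (co x) + snd (snd (co x)) * s \<le> jump d (d + s / d) sq_pos (R x + d)"
      using mean
      by eventually_elim (use quad_coeffs_le_jump[OF d s _ co] in \<open>simp add: m_def\<close>)
  qed (use pos in auto)
qed

lemma ennreal_jump:
  assumes "0 < d" "d \<le> b" "\<And>w. 0 \<le> f w"
  shows "ennreal (jump d b f w) = ennreal (d / b) * ennreal (f (w - b)) + ennreal (1 - d / b) * ennreal (f w)"
  unfolding jump_def using assms
  by (subst ennreal_plus) (auto simp: ennreal_mult[symmetric] simp del: times_divide_eq_left)

lemma nn_integral_jump:
  fixes R :: "'a \<Rightarrow> real"
  assumes "0 < d" "d \<le> b" and [measurable]: "R \<in> borel_measurable M"
  shows "(\<integral>\<^sup>+x. ennreal (jump d b sq_pos (R x)) \<partial>M)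
    = ennreal (d / b) * (\<integral>\<^sup>+x. ennreal (sq_pos (R x - b)) \<partial>M)
      + ennreal (1 - d / b) * (\<integral>\<^sup>+x. ennreal (sq_pos (R x)) \<partial>M)"
proof -
  have "ennreal (jump d b sq_pos w) = ennreal (d / b) * ennreal (sq_pos (w - b))
      + ennreal (1 - d / b) * ennreal (sq_pos w)" for w
    using assms(1,2) by (intro ennreal_jump) auto
  then show ?thesis by (simp add: nn_integral_add nn_integral_cmult)
qed

lemma fold_jump_nonneg:
  assumes "0 < d" "\<And>b. b \<in># B \<Longrightarrow> d \<le> b"
  shows "0 \<le> fold_mset (jump d) sq_pos B w"
  using assms(2) by (induction B arbitrary: w) (use assms in \<open>auto intro!: jump_nonneg\<close>)

text \<open>The increments are replaced from the last one backwards. Each replacement leaves a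
  mixture of two shifts of the problem for \<open>n\<close>, so the induction runs over all
  thresholds \<open>t\<close>.\<close>

lemma supermartingale_sq_pos_le:
  assumes "prob_space M" "supermartingale M F S" "AE x in M. S 0 x \<le> 0" "d > 0"
    and "\<And>i. i \<ge> 1 \<Longrightarrow> \<sigma> i > 0"
    and "\<And>i. i \<ge> 1 \<Longrightarrow> AE x in M. S i x - S (i - 1) x \<le> d"
    and "\<And>i. i \<ge> 1 \<Longrightarrow> AE x in M.
           cond_var M (F (i - 1)) (\<lambda>x. S i x - S (i - 1) x) x \<le> ennreal ((\<sigma> i)\<^sup>2)"
  shows "(\<integral>\<^sup>+x. ennreal (sq_pos (S n x - t)) \<partial>M)
    \<le> ennreal (fold_mset (jump d) sq_pos {#d + (\<sigma> i)\<^sup>2 / d. i \<in># mset_set {1..n}#} (real n * d - t))"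
proof (induction n arbitrary: t)
  case 0
  interpret prob_space M by fact
  have "(\<integral>\<^sup>+x. ennreal (sq_pos (S 0 x - t)) \<partial>M) \<le> (\<integral>\<^sup>+x. ennreal (sq_pos (- t)) \<partial>M)"
    using assms(3) by (intro nn_integral_mono_AE) (auto elim!: eventually_mono intro!: ennreal_leI sq_pos_mono)
  then show ?case by (simp add: emeasure_space_1)
next
  case (Suc n)
  interpret prob_space M by fact
  have sub: "subalgebra M (F n)" and int: "integrable M (S i)" and ad: "S n \<in> borel_measurable (F n)"
    and sm: "AE x in M. real_cond_exp M (F n) (S (Suc n)) x \<le> S n x" for i
    using assms(2) by (auto simp: supermartingale_def filtration_def)
  interpret finite_measure_subalgebra M "F n" by unfold_locales (rule sub)
  have [measurable]: "S n \<in> borel_measurable M" using int[of n] by auto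
  define b where "b = d + (\<sigma> (Suc n))\<^sup>2 / d"
  define V where "V = fold_mset (jump d) sq_pos {#d + (\<sigma> i)\<^sup>2 / d. i \<in># mset_set {1..n}#}"
  have b: "d \<le> b" using assms(4) by (simp add: b_def)
  have V0: "0 \<le> V w" for w unfolding V_def using assms(4) by (intro fold_jump_nonneg) auto
  have "(\<integral>\<^sup>+x. ennreal (sq_pos (S (Suc n) x - t)) \<partial>M)
      = (\<integral>\<^sup>+x. ennreal (sq_pos ((S (Suc n) x - S n x) + (S n x - t))) \<partial>M)" by simp
  also have "\<dots> \<le> (\<integral>\<^sup>+x. ennreal (jump d b sq_pos (S n x - t + d)) \<partial>M)"
    unfolding b_def
  proof (rule nn_integral_sq_pos_add_le_jump)
    show "AE x in M. real_cond_exp M (F n) (\<lambda>x. S (Suc n) x - S n x) x \<le> 0"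
      using sm real_cond_exp_diff[OF int[of "Suc n"] int[of n]] real_cond_exp_F_meas[OF int[of n] ad]
      by eventually_elim simp
    show "AE x in M. S (Suc n) x - S n x \<le> d" using assms(6)[of "Suc n"] by simp
    show "AE x in M. cond_var M (F n) (\<lambda>x. S (Suc n) x - S n x) x \<le> ennreal ((\<sigma> (Suc n))\<^sup>2)"
      using assms(7)[of "Suc n"] by simp
    show "0 < (\<sigma> (Suc n))\<^sup>2" using assms(5)[of "Suc n"] by simp
  qed (use int ad assms(4) in auto)
  also have "\<dots> = ennreal (d / b) * (\<integral>\<^sup>+x. ennreal (sq_pos (S n x - (t - d + b))) \<partial>M)
      + ennreal (1 - d / b) * (\<integral>\<^sup>+x. ennreal (sq_pos (S n x - (t - d))) \<partial>M)"
    using b assms(4) by (subst nn_integral_jump) (auto simp: algebra_simps)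
  also have "\<dots> \<le> ennreal (d / b) * ennreal (V (real n * d - (t - d + b)))
      + ennreal (1 - d / b) * ennreal (V (real n * d - (t - d)))"
    unfolding V_def by (intro add_mono mult_left_mono Suc.IH) auto
  also have "\<dots> = ennreal (jump d b V (real (Suc n) * d - t))"
    using b assms(4) V0 by (simp add: ennreal_jump algebra_simps)
  also have "jump d b V = fold_mset (jump d) sq_pos {#d + (\<sigma> i)\<^sup>2 / d. i \<in># mset_set {1..Suc n}#}"
    by (simp add: V_def b_def atLeastAtMostSuc_conv)
  finally show ?case .
qed

section \<open>Quadratic moments of the i.i.d. sum\<close>

lemma expectation_two_point_pmf:
  assumes "0 < d" "0 < s"
  shows "measure_pmf.expectation (two_point_pmf d s) f = jump d (d + s / d) f d"
proof -
  have "d\<^sup>2 + s > 0" using assms by (simp add: add_pos_pos)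
  moreover from this have "1 - s / (d\<^sup>2 + s) = d\<^sup>2 / (d\<^sup>2 + s)" by (simp add: field_simps)
  ultimately show ?thesis
    using assms by (simp add: two_point_pmf_def jump_def two_point_weights mult.commute)
qed

lemma finite_set_iid_sum_pmf: "finite (set_pmf Z) \<Longrightarrow> finite (set_pmf (iid_sum_pmf n Z))"
  by (induction n) auto

lemma finite_set_two_point_pmf: "finite (set_pmf (two_point_pmf d s))"
  by (simp add: two_point_pmf_def)

text \<open>Each summand is \<open>d - U\<close> with \<open>U\<close> a jump of size
  \<open>d + s / d\<close>, so the sum is \<open>real n * d\<close> minus \<open>n\<close>
  independent jumps.\<close>

lemma iid_sum_sq_pos_eq:
  assumes d: "0 < d" and s: "0 < s"
  shows "measure_pmf.expectation (iid_sum_pmf n (two_point_pmf d s)) (\<lambda>x. sq_pos (x - t))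
    = fold_mset (jump d) sq_pos (replicate_mset n (d + s / d)) (real n * d - t)"
proof (induction n arbitrary: t)
  case (Suc n)
  let ?Z = "two_point_pmf d s" and ?b = "d + s / d"
  let ?E = "measure_pmf.expectation (iid_sum_pmf n ?Z)"
  have fin: "finite (set_pmf (iid_sum_pmf n ?Z))" "finite (set_pmf ?Z)"
    by (auto intro: finite_set_iid_sum_pmf finite_set_two_point_pmf)
  have int: "integrable (measure_pmf (iid_sum_pmf n ?Z)) f" for f :: "real \<Rightarrow> real"
    using fin(1) by (rule integrable_measure_pmf_finite)
  have "measure_pmf.expectation (iid_sum_pmf (Suc n) ?Z) (\<lambda>x. sq_pos (x - t))
      = ?E (\<lambda>u. measure_pmf.expectation ?Z (\<lambda>z. sq_pos (u + z - t)))"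
    using fin by (simp add: pmf_expectation_bind[where A = "set_pmf (iid_sum_pmf n ?Z)"]
       integral_measure_pmf[where A = "set_pmf (iid_sum_pmf n ?Z)"])
  also have "\<dots> = ?E (\<lambda>u. d / ?b * sq_pos (u - (t - d + ?b)) + (1 - d / ?b) * sq_pos (u - (t - d)))"
    by (simp add: expectation_two_point_pmf[OF d s] jump_def algebra_simps)
  also have "\<dots> = d / ?b * ?E (\<lambda>u. sq_pos (u - (t - d + ?b))) + (1 - d / ?b) * ?E (\<lambda>u. sq_pos (u - (t - d)))"
    using int by simp
  also have "\<dots> = jump d ?b (fold_mset (jump d) sq_pos (replicate_mset n ?b)) (real (Suc n) * d - t)"
    unfolding Suc.IH by (simp add: jump_def algebra_simps)
  finally show ?case by simp
qed simp

section \<open>From quadratic moments to tails\<close>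

text \<open>The distribution function of the uniform law on [0, 1].\<close>

definition ramp :: "real \<Rightarrow> real" where
  "ramp z = max 0 (min 1 z)"

lemma ramp_nonneg [simp]: "0 \<le> ramp z"
  by (simp add: ramp_def)

lemma ramp_measurable [measurable]: "ramp \<in> borel_measurable borel"
  unfolding ramp_def by measurable

text \<open>Writes the truncated square as a mixture of indicators of \<open>u \<le> v\<close>,
  which turns truncated second moments into integrals of tails.\<close>

lemma nn_integral_linear_Icc:
  "(\<integral>\<^sup>+u. ennreal (2 * (u - t)) * indicator {t..v} u \<partial>lborel) = ennreal (sq_pos (v - t))"
proof (cases "t \<le> v")
  case True
  have "(\<integral>\<^sup>+u. ennreal (2 * (u - t)) * indicator {t..v} u \<partial>lborel) = ennreal ((v - t)\<^sup>2 - (t - t)\<^sup>2)"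
    using True
    by (intro nn_integral_FTC_Icc[where F = "\<lambda>u. (u - t)\<^sup>2"])
       (auto intro!: derivative_eq_intros)
  then show ?thesis using True by (simp add: sq_pos_eq)
next
  case False
  then show ?thesis by (simp add: sq_pos_eq)
qed

lemma sq_pos_midpoint: "2 * sq_pos c \<le> sq_pos (c + w) + sq_pos (c - w)"
proof (cases "c \<le> 0")
  case False
  then have *: "2 * sq_pos c \<le> (c + w)\<^sup>2 + (c - w)\<^sup>2"
    by (simp add: sq_pos_eq power2_eq_square algebra_simps)
  consider "c + w < 0" | "c - w < 0" | "0 \<le> c + w" "0 \<le> c - w" by linarith
  then show ?thesis
  proof cases
    case 1
    then have "2 * c \<le> c - w" by simp
    then have "(2 * c)\<^sup>2 \<le> (c - w)\<^sup>2" using False by (intro power_mono) auto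
    then have "4 * c\<^sup>2 \<le> (c - w)\<^sup>2" by (simp add: power_mult_distrib)
    then have "2 * c\<^sup>2 \<le> (c - w)\<^sup>2" using zero_le_power2[of c] by linarith
    then show ?thesis using 1 False by (simp add: sq_pos_eq)
  next
    case 2
    then have "2 * c \<le> c + w" by simp
    then have "(2 * c)\<^sup>2 \<le> (c + w)\<^sup>2" using False by (intro power_mono) auto
    then have "4 * c\<^sup>2 \<le> (c + w)\<^sup>2" by (simp add: power_mult_distrib)
    then have "2 * c\<^sup>2 \<le> (c + w)\<^sup>2" using zero_le_power2[of c] by linarith
    then show ?thesis using 2 False by (simp add: sq_pos_eq)
  qed (use * in \<open>simp add: sq_pos_eq\<close>)
qed (simp add: sq_pos_eq)

text \<open>The interval is symmetric about 0, so \<open>sq_pos (c + w)\<close> can be averaged with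
  its reflection \<open>sq_pos (c - w)\<close>, and midpoint convexity applies for each
  \<open>w\<close>.\<close>

lemma sq_pos_le_nn_integral_symmetric:
  assumes "0 < h"
  shows "ennreal h * ennreal (sq_pos c)
    \<le> (\<integral>\<^sup>+w. ennreal (sq_pos (c + w)) * indicator {- h / 2..h / 2} w \<partial>lborel)"
    (is "_ \<le> ?I")
proof -
  have "?I = (\<integral>\<^sup>+w. ennreal (sq_pos (c + (0 + - 1 * w))) * indicator {- h / 2..h / 2} (0 + - 1 * w) \<partial>lborel)"
    by (subst nn_integral_real_affine[where c = "- 1" and t = 0]) auto
  also have "\<dots> = (\<integral>\<^sup>+w. ennreal (sq_pos (c - w)) * indicator {- h / 2..h / 2} w \<partial>lborel)"
    by (intro nn_integral_cong) (auto simp: indicator_def)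
  finally have "2 * ?I = (\<integral>\<^sup>+w. ennreal (sq_pos (c + w)) * indicator {- h / 2..h / 2} w \<partial>lborel)
      + (\<integral>\<^sup>+w. ennreal (sq_pos (c - w)) * indicator {- h / 2..h / 2} w \<partial>lborel)"
    by (simp add: mult_2)
  also have "\<dots> = (\<integral>\<^sup>+w. ennreal (sq_pos (c + w)) * indicator {- h / 2..h / 2} w
      + ennreal (sq_pos (c - w)) * indicator {- h / 2..h / 2} w \<partial>lborel)"
    by (rule nn_integral_add[symmetric]) auto
  also have "\<dots> \<ge> (\<integral>\<^sup>+w. ennreal (2 * sq_pos c) * indicator {- h / 2..h / 2} w \<partial>lborel)"
    using sq_pos_midpoint[of c]
    by (intro nn_integral_mono) (auto simp: indicator_def ennreal_plus[symmetric] simp del: ennreal_plus intro!: ennreal_leI)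
  also have "(\<integral>\<^sup>+w. ennreal (2 * sq_pos c) * indicator {- h / 2..h / 2} w \<partial>lborel) = 2 * (ennreal h * ennreal (sq_pos c))"
    using assms by (subst nn_integral_cmult_indicator) (auto simp: ennreal_mult mult_ac)
  finally show ?thesis
    by (simp add: ennreal_mult_le_mult_iff)
qed

text \<open>Jensen's inequality for the convolution with the uniform law on \<open>[- h / 2, h / 2]\<close>, whose tail
  at \<open>u\<close>, when started from \<open>\<tau>\<close>, is the ramp on the right-hand side.\<close>

lemma sq_pos_le_nn_integral_ramp:
  assumes h: "0 < h"
  shows "ennreal (sq_pos (\<tau> - t))
    \<le> (\<integral>\<^sup>+u. ennreal (2 * (u - t)) * indicator {t..} u * ennreal (ramp ((\<tau> + h / 2 - u) / h)) \<partial>lborel)"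
    (is "_ \<le> ?R")
proof -
  \<comment> \<open>Both sides are the length of the set of \<open>w\<close> in the interval with
    \<open>u \<le> \<tau> + w\<close>.\<close>
  have ramp: "ennreal h * ennreal (ramp ((\<tau> + h / 2 - u) / h))
      = (\<integral>\<^sup>+w. indicator {- h / 2..h / 2} w * indicator {..\<tau> + w} u \<partial>lborel)" for u
  proof -
    have "(\<integral>\<^sup>+w. indicator {- h / 2..h / 2} w * indicator {..\<tau> + w} u \<partial>lborel)
       = (\<integral>\<^sup>+w. indicator {max (- h / 2) (u - \<tau>)..h / 2} w \<partial>lborel)"
      by (intro nn_integral_cong) (auto simp: indicator_def)
    also have "\<dots> = ennreal (max 0 (h / 2 - max (- h / 2) (u - \<tau>)))"
      by (auto simp: max_def)
    also have "max 0 (h / 2 - max (- h / 2) (u - \<tau>)) = h * ramp ((\<tau> + h / 2 - u) / h)"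
      using h by (auto simp: ramp_def max_def min_def field_simps)
    finally show ?thesis using h by (simp add: ennreal_mult)
  qed
  have "ennreal h * ennreal (sq_pos (\<tau> - t))
     \<le> (\<integral>\<^sup>+w. ennreal (sq_pos (\<tau> - t + w)) * indicator {- h / 2..h / 2} w \<partial>lborel)"
    by (rule sq_pos_le_nn_integral_symmetric[OF h])
  also have "\<dots> = (\<integral>\<^sup>+w. (\<integral>\<^sup>+u. ennreal (2 * (u - t)) * indicator {t..} u *
      (indicator {- h / 2..h / 2} w * indicator {..\<tau> + w} u) \<partial>lborel) \<partial>lborel)"
  proof (rule nn_integral_cong)
    fix w
    have "ennreal (sq_pos (\<tau> - t + w)) * indicator {- h / 2..h / 2} w
      = (\<integral>\<^sup>+u. ennreal (2 * (u - t)) * indicator {t..\<tau> + w} u \<partial>lborel) * indicator {- h / 2..h / 2} w"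
      unfolding nn_integral_linear_Icc by (simp add: algebra_simps)
    also have "\<dots> = (\<integral>\<^sup>+u. ennreal (2 * (u - t)) * indicator {t..\<tau> + w} u * indicator {- h / 2..h / 2} w \<partial>lborel)"
      by (rule nn_integral_multc[symmetric]) auto
    also have "\<dots> = (\<integral>\<^sup>+u. ennreal (2 * (u - t)) * indicator {t..} u *
      (indicator {- h / 2..h / 2} w * indicator {..\<tau> + w} u) \<partial>lborel)"
      by (intro nn_integral_cong) (auto simp: indicator_def)
    finally show "ennreal (sq_pos (\<tau> - t + w)) * indicator {- h / 2..h / 2} w = \<dots>" .
  qed
  also have "\<dots> = (\<integral>\<^sup>+u. (\<integral>\<^sup>+w. ennreal (2 * (u - t)) * indicator {t..} u *
      (indicator {- h / 2..h / 2} w * indicator {..\<tau> + w} u) \<partial>lborel) \<partial>lborel)"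
    by (rule lborel_pair.Fubini') (auto simp: indicator_def[of "{.._}"])
  also have "\<dots> = (\<integral>\<^sup>+u. ennreal h * (ennreal (2 * (u - t)) * indicator {t..} u * ennreal (ramp ((\<tau> + h / 2 - u) / h))) \<partial>lborel)"
  proof (rule nn_integral_cong)
    fix u
    have "(\<lambda>w. indicator {..\<tau> + w} u :: ennreal) \<in> borel_measurable borel"
      by (simp add: indicator_def)
    then have "(\<integral>\<^sup>+w. ennreal (2 * (u - t)) * indicator {t..} u *
        (indicator {- h / 2..h / 2} w * indicator {..\<tau> + w} u) \<partial>lborel)
      = ennreal (2 * (u - t)) * indicator {t..} u *
        (\<integral>\<^sup>+w. indicator {- h / 2..h / 2} w * indicator {..\<tau> + w} u \<partial>lborel)"
      by (intro nn_integral_cmult) auto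
    then show "(\<integral>\<^sup>+w. ennreal (2 * (u - t)) * indicator {t..} u *
        (indicator {- h / 2..h / 2} w * indicator {..\<tau> + w} u) \<partial>lborel)
      = ennreal h * (ennreal (2 * (u - t)) * indicator {t..} u * ennreal (ramp ((\<tau> + h / 2 - u) / h)))"
      unfolding ramp[symmetric] by (simp only: mult_ac)
  qed
  also have "\<dots> = ennreal h * ?R"
    by (rule nn_integral_cmult) auto
  finally show ?thesis using h by (simp add: ennreal_mult_le_mult_iff)
qed

section \<open>Exponential bounds on the interpolated tail\<close>

lemma nn_integral_linear_exp:
  assumes l: "0 < l" and K: "0 \<le> K"
  shows "(\<integral>\<^sup>+u. ennreal (2 * (u - t)) * indicator {t..} u * ennreal (K * exp (- l * u)) \<partial>lborel)
    = ennreal (2 * K * exp (- l * t) / l\<^sup>2)"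
proof -
  \<comment> \<open>An antiderivative of the integrand that vanishes at infinity, so the integral is
    \<open>- G t\<close>.\<close>
  define G where "G u = - 2 * K * exp (- l * u) * ((u - t) / l + 1 / l\<^sup>2)" for u
  have "(\<integral>\<^sup>+u. ennreal (2 * (u - t)) * indicator {t..} u * ennreal (K * exp (- l * u)) \<partial>lborel)
    = (\<integral>\<^sup>+u. ennreal (2 * (u - t) * (K * exp (- l * u))) * indicator {t..} u \<partial>lborel)"
    using K by (intro nn_integral_cong) (auto simp: indicator_def ennreal_mult)
  also have "\<dots> = ennreal (0 - G t)"
  proof (rule nn_integral_FTC_atLeast)
    show "DERIV G u :> 2 * (u - t) * (K * exp (- l * u))" for u
      unfolding G_def using l
      by (auto intro!: derivative_eq_intros simp: field_simps power2_eq_square)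
    have "((\<lambda>u. exp (- l * u) * ((u - t) / l + 1 / l\<^sup>2)) \<longlongrightarrow> 0) at_top"
      using l by real_asymp
    then have "((\<lambda>u. - 2 * K * (exp (- l * u) * ((u - t) / l + 1 / l\<^sup>2))) \<longlongrightarrow> - 2 * K * 0) at_top"
      by (intro tendsto_mult tendsto_const)
    then show "(G \<longlongrightarrow> 0) at_top" by (simp add: G_def[abs_def] mult.assoc)
  qed (use K in auto)
  finally show ?thesis by (simp add: G_def)
qed

lemma tail_lin_eq_frac:
  assumes "0 < h"
  shows "tail_lin T a h z = (1 - frac ((z - a) / h)) * tail T (a + of_int \<lfloor>(z - a) / h\<rfloor> * h)
    + frac ((z - a) / h) * tail T (a + of_int (\<lfloor>(z - a) / h\<rfloor> + 1) * h)"
proof -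
  have "(z - a - of_int \<lfloor>(z - a) / h\<rfloor> * h) / h = frac ((z - a) / h)"
    using assms by (simp add: frac_def diff_divide_distrib)
  then show ?thesis by (simp only: tail_lin_def Let_def)
qed

text \<open>The interpolated tail, shifted by \<open>h / 2\<close>, is the tail of \<open>T\<close> convolved with the uniform law on
  \<open>[- h / 2, h / 2]\<close>.\<close>

lemma tail_lin_eq_expectation_ramp:
  assumes h: "0 < h" and fin: "finite (set_pmf T)"
    and lattice: "\<And>\<tau>. \<tau> \<in> set_pmf T \<Longrightarrow> \<exists>j::int. \<tau> = a + of_int j * h"
  shows "tail_lin T a h (u + h / 2) = measure_pmf.expectation T (\<lambda>\<tau>. ramp ((\<tau> + h / 2 - u) / h))"
proof -
  define z where "z = (u + h / 2 - a) / h"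
  define k where "k = \<lfloor>z\<rfloor>"
  define \<gamma> where "\<gamma> = z - of_int k"
  have g01: "0 \<le> \<gamma>" "\<gamma> < 1" unfolding \<gamma>_def k_def by linarith+
  have int: "integrable (measure_pmf T) f" for f :: "real \<Rightarrow> real"
    using fin by (rule integrable_measure_pmf_finite)
  have "tail_lin T a h (u + h / 2) = (1 - \<gamma>) * tail T (a + of_int k * h) + \<gamma> * tail T (a + of_int (k + 1) * h)"
    unfolding tail_lin_eq_frac[OF h] by (simp add: frac_def z_def[symmetric] k_def[symmetric] \<gamma>_def)
  also have "\<dots> = measure_pmf.expectation T (\<lambda>\<tau>. (1 - \<gamma>) * indicator {a + of_int k * h..} \<tau>
      + \<gamma> * indicator {a + of_int (k + 1) * h..} \<tau>)"
    using int by (simp add: tail_def atLeast_def)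
  also have "\<dots> = measure_pmf.expectation T (\<lambda>\<tau>. ramp ((\<tau> + h / 2 - u) / h))"
  proof (intro integral_cong_AE)
    show "AE \<tau> in measure_pmf T. (1 - \<gamma>) * indicator {a + of_int k * h..} \<tau>
      + \<gamma> * indicator {a + of_int (k + 1) * h..} \<tau> = ramp ((\<tau> + h / 2 - u) / h)"
    proof (rule AE_pmfI)
      fix \<tau> assume "\<tau> \<in> set_pmf T"
      then obtain j :: int where j: "\<tau> = a + of_int j * h" using lattice by blast
      have arg: "(\<tau> + h / 2 - u) / h = of_int j + 1 - of_int k - \<gamma>"
        using h by (simp add: j \<gamma>_def z_def field_simps)
      have ind: "\<tau> \<in> {a + of_int i * h..} \<longleftrightarrow> i \<le> j" for i
        using h by (simp add: j)
      \<comment> \<open>In the three cases the argument of the ramp is at most 0, equal to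
        \<open>1 - \<gamma>\<close>, and at least 1; only \<open>j = k\<close> meets the linear
        range.\<close>
      consider "j \<le> k - 1" | "j = k" | "k + 1 \<le> j" by linarith
      then show "(1 - \<gamma>) * indicator {a + of_int k * h..} \<tau>
        + \<gamma> * indicator {a + of_int (k + 1) * h..} \<tau> = ramp ((\<tau> + h / 2 - u) / h)"
      proof cases
        case 1
        then have "real_of_int j \<le> real_of_int k - 1" by linarith
        then show ?thesis using 1 g01 unfolding arg indicator_def ind by (simp add: ramp_def)
      next
        case 2
        then show ?thesis using g01 unfolding arg indicator_def ind by (simp add: ramp_def)
      next
        case 3
        then have "real_of_int k + 1 \<le> real_of_int j" by linarith
        then show ?thesis using 3 g01 unfolding arg indicator_def ind by (simp add: ramp_def)
      qed
    qed
  qed auto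
  finally show ?thesis .
qed

text \<open>By Jensen's inequality the moment is at most that of \<open>T\<close> with uniform noise
  added, which is the integral of \<open>2 * (u - t)\<close> against the interpolated tail.
  Replacing this tail by the exponential makes the integral explicit.\<close>

lemma sq_pos_expectation_le_exp:
  assumes h: "0 < h" and fin: "finite (set_pmf T)"
    and lattice: "\<And>\<tau>. \<tau> \<in> set_pmf T \<Longrightarrow> \<exists>j::int. \<tau> = a + of_int j * h"
    and l: "0 < l" and K: "0 \<le> K"
    and bound: "\<And>u. tail_lin T a h (u + h / 2) \<le> K * exp (- l * u)"
  shows "measure_pmf.expectation T (\<lambda>x. sq_pos (x - t)) \<le> 2 * K * exp (- l * t) / l\<^sup>2"
proof -
  let ?g = "\<lambda>u. ennreal (2 * (u - t)) * indicator {t..} u"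
  let ?r = "\<lambda>\<tau> u. ramp ((\<tau> + h / 2 - u) / h)"
  have int: "integrable (measure_pmf T) f" for f :: "real \<Rightarrow> real"
    using fin by (rule integrable_measure_pmf_finite)
  have "ennreal (measure_pmf.expectation T (\<lambda>x. sq_pos (x - t))) = (\<integral>\<^sup>+\<tau>. ennreal (sq_pos (\<tau> - t)) \<partial>measure_pmf T)"
    using int by (intro nn_integral_eq_integral[symmetric]) auto
  also have "\<dots> \<le> (\<integral>\<^sup>+\<tau>. (\<integral>\<^sup>+u. ?g u * ennreal (?r \<tau> u) \<partial>lborel) \<partial>measure_pmf T)"
    using h by (intro nn_integral_mono sq_pos_le_nn_integral_ramp)
  also have "\<dots> = (\<integral>\<^sup>+u. (\<integral>\<^sup>+\<tau>. ?g u * ennreal (?r \<tau> u) \<partial>measure_pmf T) \<partial>lborel)"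
    using fin by (simp add: nn_integral_measure_pmf_finite nn_integral_sum nn_integral_multc)
  also have "\<dots> = (\<integral>\<^sup>+u. ?g u * ennreal (tail_lin T a h (u + h / 2)) \<partial>lborel)"
    using int by (simp add: nn_integral_cmult nn_integral_eq_integral tail_lin_eq_expectation_ramp[OF h fin lattice])
  also have "\<dots> \<le> (\<integral>\<^sup>+u. ?g u * ennreal (K * exp (- l * u)) \<partial>lborel)"
    using bound by (intro nn_integral_mono mult_left_mono ennreal_leI) auto
  also have "\<dots> = ennreal (2 * K * exp (- l * t) / l\<^sup>2)"
    by (rule nn_integral_linear_exp[OF l K])
  finally show ?thesis using K by (subst (asm) ennreal_le_iff) auto
qed

text \<open>A supporting line of the concave function \<open>ln g\<close> at \<open>y\<close>,
  exponentiated. At an interior point of the positivity set the slope is finite; where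
  \<open>g\<close> vanishes the bound is trivial.\<close>

lemma log_concave_exp_bound:
  assumes lc: "log_concave g" and y: "y \<in> interior {u. 0 < g u}"
  obtains l where "\<And>u. g u \<le> g y * exp (- l * (u - y))"
proof -
  let ?I = "{u. 0 < g u}"
  have pw: "(1 - t) * ln (g x) + t * ln (g z) \<le> ln (g ((1 - t) * x + t * z)) \<and> 0 < g ((1 - t) * x + t * z)"
    if "0 < t" "t < 1" "x \<in> ?I" "z \<in> ?I" for t x z
  proof -
    have "exp ((1 - t) * ln (g x) + t * ln (g z)) = g x powr (1 - t) * g z powr t"
      using that by (simp add: powr_def exp_add)
    also have "\<dots> \<le> g ((1 - t) * x + t * z)" using lc that by (simp add: log_concave_def)
    finally have *: "exp ((1 - t) * ln (g x) + t * ln (g z)) \<le> g ((1 - t) * x + t * z)" .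
    then have pos: "0 < g ((1 - t) * x + t * z)" by (rule less_le_trans[OF exp_gt_zero])
    with * show ?thesis by (simp add: ln_ge_iff)
  qed
  have "convex ?I"
  proof (rule convexI)
    fix x z u v :: real
    assume A: "x \<in> ?I" "z \<in> ?I" "0 \<le> u" "0 \<le> v" "u + v = 1"
    then consider "v = 0" "u = 1" | "v = 1" "u = 0" | "0 < v" "v < 1" "u = 1 - v" by fastforce
    then show "u *\<^sub>R x + v *\<^sub>R z \<in> ?I"
    proof cases
      case 3
      then show ?thesis using A pw[of v x z] unfolding 3(3) by simp
    qed (use A in auto)
  qed
  then have cv: "convex_on ?I (\<lambda>u. - ln (g u))"
    using pw by (intro convex_onI) (auto simp: algebra_simps)
  \<comment> \<open>The right derivative of the convex function \<open>- ln g\<close> at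
    \<open>y\<close>, as an infimum of difference quotients.\<close>
  define l where "l = Inf ((\<lambda>t. (- ln (g y) - - ln (g t)) / (y - t)) ` ({y<..} \<inter> ?I))"
  have y0: "0 < g y" using y interior_subset by auto
  have "g u \<le> g y * exp (- l * (u - y))" for u
  proof (cases "0 < g u")
    case True
    then have "- ln (g u) \<ge> - ln (g y) + l * (u - y)"
      unfolding l_def by (intro convex_le_Inf_differential[OF cv y]) auto
    then have "ln (g u) \<le> ln (g y) + - l * (u - y)" by simp
    then have "exp (ln (g u)) \<le> exp (ln (g y) + - l * (u - y))" by (simp only: exp_le_cancel_iff)
    then show ?thesis using True y0 unfolding exp_add by simp
  next
    case False
    then have "g u \<le> 0" by simp
    also have "0 \<le> g y * exp (- l * (u - y))" using y0 by simp
    finally show ?thesis .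
  qed
  then show ?thesis using that by blast
qed

lemma tail_nonneg [simp]: "0 \<le> tail T y"
  by (simp add: tail_def)

text \<open>Interpolation carries the tail one lattice cell past the atom \<open>a\<close>. With
  \<open>a\<close> the top atom, \<open>y + h / 2\<close> is thus interior to the positivity set for
  every \<open>y \<le> a\<close>.\<close>

lemma tail_lin_pos:
  assumes h: "0 < h" and a: "a \<in> set_pmf T" and z: "z < a + h"
  shows "0 < tail_lin T a h z"
proof -
  define k where "k = \<lfloor>(z - a) / h\<rfloor>"
  define \<gamma> where "\<gamma> = frac ((z - a) / h)"
  have g01: "0 \<le> \<gamma>" "\<gamma> < 1" unfolding \<gamma>_def by (auto simp: frac_lt_1)
  have "(z - a) / h < 1" using h z by simp
  then have "k \<le> 0" unfolding k_def by linarith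
  then have "of_int k * h \<le> 0" using h by (simp add: mult_le_0_iff)
  then have "0 < tail T (a + of_int k * h)"
    unfolding tail_def using a by (intro measure_pmf_posI[of a]) auto
  then have "0 < (1 - \<gamma>) * tail T (a + of_int k * h) + \<gamma> * tail T (a + of_int (k + 1) * h)"
    using g01 by (intro add_pos_nonneg mult_pos_pos mult_nonneg_nonneg) auto
  then show ?thesis unfolding tail_lin_eq_frac[OF h] by (simp add: k_def \<gamma>_def)
qed

lemma tail_lin_le_1:
  assumes h: "0 < h"
  shows "tail_lin T a h z \<le> 1"
proof -
  define k where "k = \<lfloor>(z - a) / h\<rfloor>"
  define \<gamma> where "\<gamma> = frac ((z - a) / h)"
  have g01: "0 \<le> \<gamma>" "\<gamma> < 1" unfolding \<gamma>_def by (auto simp: frac_lt_1)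
  have "(1 - \<gamma>) * tail T (a + of_int k * h) + \<gamma> * tail T (a + of_int (k + 1) * h) \<le> (1 - \<gamma>) * 1 + \<gamma> * 1"
    unfolding tail_def using g01 by (intro add_mono mult_left_mono measure_pmf.prob_le_1) auto
  then show ?thesis unfolding tail_lin_eq_frac[OF h] by (simp add: k_def \<gamma>_def)
qed

text \<open>The margin \<open>h\<close> is due to the interpolation, which also uses the tail at the
  next lattice point above \<open>z\<close>.\<close>

lemma tail_lin_eq_1:
  assumes h: "0 < h" and L: "\<And>\<tau>. \<tau> \<in> set_pmf T \<Longrightarrow> L \<le> \<tau>" and z: "z \<le> L - h"
  shows "tail_lin T a h z = 1"
proof -
  define k where "k = \<lfloor>(z - a) / h\<rfloor>"
  define \<gamma> where "\<gamma> = frac ((z - a) / h)"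
  have "of_int k \<le> (z - a) / h" unfolding k_def by simp
  then have "of_int k * h \<le> z - a" using h by (simp add: field_simps)
  then have "a + of_int k * h \<le> L" "a + of_int (k + 1) * h \<le> L" using z h by (auto simp: algebra_simps)
  then have "tail T (a + of_int k * h) = 1" "tail T (a + of_int (k + 1) * h) = 1"
    unfolding tail_def by (auto intro!: measure_pmf.prob_eq_1[THEN iffD2] AE_pmfI dest!: L)
  then show ?thesis unfolding tail_lin_eq_frac[OF h] by (simp add: k_def \<gamma>_def)
qed

section \<open>Markov's inequality and the log-concave majorant\<close>

lemma (in prob_space) prob_ge_mult_le_nn_integral_sq_pos:
  assumes [measurable]: "S \<in> borel_measurable M" and "t \<le> y"
  shows "ennreal ((y - t)\<^sup>2 * prob {x \<in> space M. y \<le> S x}) \<le> (\<integral>\<^sup>+x. ennreal (sq_pos (S x - t)) \<partial>M)"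
proof -
  have "ennreal ((y - t)\<^sup>2 * prob {x \<in> space M. y \<le> S x})
      = (\<integral>\<^sup>+x. ennreal ((y - t)\<^sup>2) * indicator {x \<in> space M. y \<le> S x} x \<partial>M)"
    by (subst nn_integral_cmult_indicator) (auto simp: ennreal_mult emeasure_eq_measure)
  also have "\<dots> \<le> (\<integral>\<^sup>+x. ennreal (sq_pos (S x - t)) \<partial>M)"
    using assms(2)
    by (intro nn_integral_mono) (auto simp: indicator_def sq_pos_def intro!: ennreal_leI power_mono)
  finally show ?thesis .
qed

lemma (in prob_space) prob_le_lc_majorant:
  assumes h: "0 < h" and fin: "finite (set_pmf T)"
    and lattice: "\<And>\<tau>. \<tau> \<in> set_pmf T \<Longrightarrow> \<exists>j::int. \<tau> = a + of_int j * h"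
    and a: "a \<in> set_pmf T" and le_a: "\<And>\<tau>. \<tau> \<in> set_pmf T \<Longrightarrow> \<tau> \<le> a"
    and S [measurable]: "S \<in> borel_measurable M"
    and dom: "\<And>t. (\<integral>\<^sup>+x. ennreal (sq_pos (S x - t)) \<partial>M)
                \<le> ennreal (measure_pmf.expectation T (\<lambda>x. sq_pos (x - t)))"
  shows "prob {x \<in> space M. y \<le> S x} \<le> exp 2 / 2 * lc_majorant (tail_lin T a h) (y + h / 2)"
proof -
  let ?P = "prob {x \<in> space M. y \<le> S x}"
  have markov: "(y - t)\<^sup>2 * ?P \<le> measure_pmf.expectation T (\<lambda>x. sq_pos (x - t))" if "t \<le> y" for t
    using order_trans[OF prob_ge_mult_le_nn_integral_sq_pos[OF S that] dom[of t]]
    by (subst (asm) ennreal_le_iff) (auto intro!: integral_nonneg_AE)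
  have e2: "(1::real) \<le> exp 2 / 2" using exp_ge_add_one_self[of 2] by simp
  have main: "?P \<le> exp 2 / 2 * g (y + h / 2)" if lc: "log_concave g" and ge: "\<And>x. tail_lin T a h x \<le> g x" for g
  proof -
    have g0: "0 \<le> g x" for x using lc by (simp add: log_concave_def)
    \<comment> \<open>Beyond \<open>a\<close> the moment with \<open>t = a\<close> vanishes, and for
      \<open>g (y + h / 2) \<ge> 1\<close> the factor \<open>exp 2 / 2 \<ge> 1\<close> suffices. In
      the remaining case the supporting exponential is decreasing.\<close>
    consider "a < y" | "y \<le> a" "1 \<le> g (y + h / 2)" | "y \<le> a" "g (y + h / 2) < 1" by linarith
    then show ?thesis
    proof cases
      case 1
      have "measure_pmf.expectation T (\<lambda>x. sq_pos (x - a)) = measure_pmf.expectation T (\<lambda>x. 0)"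
        using le_a by (intro integral_cong_AE) (auto intro!: AE_pmfI simp: sq_pos_eq)
      then have "(y - a)\<^sup>2 * ?P \<le> 0" using markov[of a] 1 by simp
      moreover have "0 < (y - a)\<^sup>2" using 1 by simp
      ultimately have "?P \<le> 0" by (simp add: mult_le_0_iff)
      also have "0 \<le> exp 2 / 2 * g (y + h / 2)" using g0 by simp
      finally show ?thesis .
    next
      case 2
      have "?P \<le> 1 * 1" by simp
      also have "\<dots> \<le> exp 2 / 2 * g (y + h / 2)" using 2 e2 by (intro mult_mono) auto
      finally show ?thesis .
    next
      case 3
      define Y where "Y = y + h / 2"
      have "{..<a + h} \<subseteq> {u. 0 < g u}" using tail_lin_pos[OF h a] ge by (auto intro: less_le_trans)
      then have "{..<a + h} \<subseteq> interior {u. 0 < g u}" by (intro interior_maximal) auto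
      then have Yint: "Y \<in> interior {u. 0 < g u}" using 3 h by (auto simp: Y_def)
      then have Y0: "0 < g Y" using interior_subset by auto
      obtain l where l: "\<And>u. g u \<le> g Y * exp (- l * (u - Y))"
        using log_concave_exp_bound[OF lc Yint] by blast
      \<comment> \<open>To the left of \<open>Y\<close> the interpolated tail reaches 1, so
        \<open>g u \<ge> 1\<close> while \<open>g Y < 1\<close>; this forces \<open>l\<close> to be
        positive.\<close>
      define u where "u = min (Y - 1) (Min (set_pmf T) - h)"
      have "tail_lin T a h u = 1"
        using h fin by (intro tail_lin_eq_1[where L = "Min (set_pmf T)"]) (auto simp: u_def)
      then have "1 \<le> g Y * exp (- l * (u - Y))" using ge[of u] l[of u] by linarith
      moreover have "u < Y" by (simp add: u_def)
      ultimately have "0 < l"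
      proof -
        have "1 < exp (- l * (u - Y))"
        proof (rule ccontr)
          assume "\<not> 1 < exp (- l * (u - Y))"
          then have "g Y * exp (- l * (u - Y)) \<le> g Y * 1" using Y0 by (intro mult_left_mono) auto
          then show False using \<open>1 \<le> g Y * _\<close> 3 by (simp add: Y_def)
        qed
        then have "0 < l * (Y - u)" by (simp add: algebra_simps)
        then show ?thesis using \<open>u < Y\<close> by (simp add: zero_less_mult_iff)
      qed
      \<comment> \<open>This \<open>t\<close> minimizes
        \<open>exp (- l * t) / (y - t)\<^sup>2\<close> over \<open>t < y\<close>. The distance
        \<open>2 / l\<close> gives the factors \<open>exp 2\<close> and
        \<open>4 / l\<^sup>2\<close>, hence the constant \<open>exp 2 / 2\<close>.\<close>
      define t where "t = y - 2 / l"
      have "measure_pmf.expectation T (\<lambda>x. sq_pos (x - t)) \<le> 2 * (g Y * exp (l * y)) * exp (- l * t) / l\<^sup>2"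
      proof (rule sq_pos_expectation_le_exp[OF h fin lattice \<open>0 < l\<close>])
        \<comment> \<open>Since \<open>Y = y + h / 2\<close>, the shift by \<open>h / 2\<close>
          cancels in the exponent.\<close>
        show "tail_lin T a h (v + h / 2) \<le> g Y * exp (l * y) * exp (- l * v)" for v
          using order_trans[OF ge[of "v + h / 2"] l[of "v + h / 2"]]
          unfolding mult.assoc mult_exp_exp by (simp add: Y_def algebra_simps)
      qed (use Y0 in auto)
      also have "\<dots> = 2 * g Y * (exp (l * y) * exp (- l * t)) / l\<^sup>2" by simp
      also have "exp (l * y) * exp (- l * t) = exp 2"
        unfolding mult_exp_exp using \<open>0 < l\<close> by (simp add: t_def right_diff_distrib)
      finally have "(y - t)\<^sup>2 * ?P \<le> 2 * g Y * exp 2 / l\<^sup>2"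
        using markov[of t] \<open>0 < l\<close> by (auto simp: t_def)
      moreover have "(y - t)\<^sup>2 = 4 / l\<^sup>2" by (simp add: t_def power_divide)
      ultimately have "4 * ?P / l\<^sup>2 \<le> 2 * g Y * exp 2 / l\<^sup>2" by simp
      then have "4 * ?P \<le> 2 * g Y * exp 2" using \<open>0 < l\<close> by (simp add: divide_le_cancel)
      then show ?thesis by (simp add: Y_def)
    qed
  qed
  have "2 / exp 2 * ?P \<le> lc_majorant (tail_lin T a h) (y + h / 2)"
    unfolding lc_majorant_def
  proof (rule cInf_greatest)
    have "log_concave (\<lambda>_. 1)" by (simp add: log_concave_def)
    then show "{g (y + h / 2) |g. log_concave g \<and> (\<forall>x. tail_lin T a h x \<le> g x)} \<noteq> {}"
      using tail_lin_le_1[OF h] by blast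
    show "2 / exp 2 * ?P \<le> v" if "v \<in> {g (y + h / 2) |g. log_concave g \<and> (\<forall>x. tail_lin T a h x \<le> g x)}" for v
      using that main by (auto simp: field_simps)
  qed
  then show ?thesis by (simp add: field_simps)
qed

text \<open>\<open>j\<close> counts the summands at the lower atom \<open>- s / d\<close>, which
  lies \<open>d + s / d\<close> below the upper one.\<close>

lemma set_iid_sum_two_point_pmf:
  assumes "\<tau> \<in> set_pmf (iid_sum_pmf n (two_point_pmf d s))"
  shows "\<exists>j\<le>n. \<tau> = real n * d - real j * (d + s / d)"
  using assms
proof (induction n arbitrary: \<tau>)
  case (Suc n)
  then obtain u z where u: "u \<in> set_pmf (iid_sum_pmf n (two_point_pmf d s))"
    and z: "z \<in> set_pmf (two_point_pmf d s)" and \<tau>: "\<tau> = u + z"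
    by auto
  from Suc.IH[OF u] obtain j where j: "j \<le> n" "u = real n * d - real j * (d + s / d)" by blast
  from z have "z = d \<or> z = - s / d" by (auto simp: two_point_pmf_def)
  then show ?case
  proof
    assume "z = d"
    then show ?thesis using j by (intro exI[of _ j]) (auto simp: \<tau> algebra_simps)
  next
    assume "z = - s / d"
    then show ?thesis using j by (intro exI[of _ "Suc j"]) (auto simp: \<tau> algebra_simps)
  qed
qed simp

lemma max_in_set_iid_sum_two_point_pmf:
  assumes "0 < d" "0 < s"
  shows "real n * d \<in> set_pmf (iid_sum_pmf n (two_point_pmf d s))"
proof (induction n)
  case (Suc n)
  have "d\<^sup>2 + s > 0" using assms by (simp add: add_pos_pos)
  then have "s / (d\<^sup>2 + s) \<in> {0<..<1}" using assms by simp
  then have "d \<in> set_pmf (two_point_pmf d s)"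
    by (auto simp: two_point_pmf_def set_pmf_bernoulli intro!: image_eqI[of _ _ True])
  then show ?case using Suc
    by (auto intro!: bexI[OF _ Suc] image_eqI[of _ _ d] simp: algebra_simps)
qed simp

theorem theorem2p3:
  fixes M :: "'a measure" and F :: "nat \<Rightarrow> 'a measure" and S :: "nat \<Rightarrow> 'a \<Rightarrow> real"
    and d :: real and \<sigma> :: "nat \<Rightarrow> real" and n :: nat and y :: real
  assumes "prob_space M"
    and "supermartingale M F S"
    and "AE x in M. S 0 x \<le> 0"
    and "d > 0"
    and "\<And>i. i \<ge> 1 \<Longrightarrow> \<sigma> i > 0"
    and "\<And>i. i \<ge> 1 \<Longrightarrow> AE x in M. S i x - S (i - 1) x \<le> d"
    and "\<And>i. i \<ge> 1 \<Longrightarrow> AE x in M.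
           cond_var M (F (i - 1)) (\<lambda>x. S i x - S (i - 1) x) x \<le> ennreal ((\<sigma> i)\<^sup>2)"
    and "n \<ge> 1"
  shows "let s2 = (\<Sum>i=1..n. (\<sigma> i)\<^sup>2) / real n;
             h = d + s2 / d;
             T = iid_sum_pmf n (two_point_pmf d s2)
         in measure M {x \<in> space M. y \<le> S n x}
              \<le> exp 2 / 2 * lc_majorant (tail_lin T (real n * d) h) (y + h / 2)"
proof -
  interpret prob_space M by fact
  define s2 where "s2 = (\<Sum>i=1..n. (\<sigma> i)\<^sup>2) / real n"
  define h where "h = d + s2 / d"
  define T where "T = iid_sum_pmf n (two_point_pmf d s2)"
  \<comment> \<open>The jump sizes are affine in the variances, so their mean is \<open>h\<close>,
    the jump size for the averaged variance \<open>s2\<close>.\<close>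
  define B where "B = {#d + (\<sigma> i)\<^sup>2 / d. i \<in># mset_set {1..n}#}"
  have "(\<Sum>i=1..n. (\<sigma> i)\<^sup>2) > 0"
    using assms(5,8) by (intro sum_pos) (auto simp: less_imp_neq[THEN not_sym])
  then have s2: "0 < s2" using assms(8) by (simp add: s2_def)
  have h: "0 < h" using s2 assms(4) by (simp add: h_def add_pos_pos)
  have size: "size B = n" by (simp add: B_def)
  have "sum_mset B = (\<Sum>i=1..n. d + (\<sigma> i)\<^sup>2 / d)"
    unfolding B_def by (rule sum_unfold_sum_mset[symmetric])
  also have "\<dots> = real n * d + (\<Sum>i=1..n. (\<sigma> i)\<^sup>2) / d" by (simp add: sum.distrib sum_divide_distrib)
  also have "\<dots> = real (size B) * h"
    unfolding size using assms(8) by (simp add: h_def s2_def field_simps)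
  finally have sumB: "sum_mset B = real (size B) * h" .
  have "prob {x \<in> space M. y \<le> S n x} \<le> exp 2 / 2 * lc_majorant (tail_lin T (real n * d) h) (y + h / 2)"
  proof (rule prob_le_lc_majorant[OF h])
    show "finite (set_pmf T)"
      unfolding T_def by (intro finite_set_iid_sum_pmf finite_set_two_point_pmf)
    show "real n * d \<in> set_pmf T"
      unfolding T_def by (rule max_in_set_iid_sum_two_point_pmf[OF assms(4) s2])
    show "S n \<in> borel_measurable M"
      using assms(2) by (auto simp: supermartingale_def)
    fix \<tau> assume "\<tau> \<in> set_pmf T"
    then obtain j where j: "\<tau> = real n * d - real j * h"
      unfolding T_def h_def using set_iid_sum_two_point_pmf by blast
    then show "\<exists>j::int. \<tau> = real n * d + of_int j * h" by (intro exI[of _ "- int j"]) simp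
    show "\<tau> \<le> real n * d" using j h by simp
  next
    fix t
    have "(\<integral>\<^sup>+x. ennreal (sq_pos (S n x - t)) \<partial>M) \<le> ennreal (fold_mset (jump d) sq_pos B (real n * d - t))"
      unfolding B_def by (rule supermartingale_sq_pos_le[OF assms(1-7)])
    also have "\<dots> \<le> ennreal (fold_mset (jump d) sq_pos (replicate_mset n h) (real n * d - t))"
    proof (rule ennreal_leI)
      have "d \<le> b" if "b \<in># B" for b using that assms(4) by (auto simp: B_def)
      then show "fold_mset (jump d) sq_pos B (real n * d - t)
          \<le> fold_mset (jump d) sq_pos (replicate_mset n h) (real n * d - t)"
        using fold_jump_le_replicate_mean[OF assms(4) _ sumB] by (simp add: le_fun_def size)
    qed
    also have "fold_mset (jump d) sq_pos (replicate_mset n h) (real n * d - t)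
        = measure_pmf.expectation T (\<lambda>x. sq_pos (x - t))"
      unfolding T_def h_def by (rule iid_sum_sq_pos_eq[OF assms(4) s2, symmetric])
    finally show "(\<integral>\<^sup>+x. ennreal (sq_pos (S n x - t)) \<partial>M)
      \<le> ennreal (measure_pmf.expectation T (\<lambda>x. sq_pos (x - t)))" .
  qed
  then show ?thesis by (simp only: Let_def s2_def[symmetric] h_def[symmetric] T_def[symmetric])
qed

end
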